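(* Let $G$ be the $5$-cycle with nodes $1,\dots,5$ and edges $12,13,24,35,45$, and let $\Phi$ be the priority policy under which node $1$ prioritizes $2$ over $3$, node $2$ prioritizes $1$ over $4$, node $3$ prioritizes $1$ over $5$, node $4$ prioritizes $2$ over $5$, and node $5$ prioritizes $4$ over $3$. Let $\lambda\in\mathrm{Ncond}(G)$. If the matching queue $(G,\lambda,\Phi)$ is stable, then $\lambda_5<a\,\tilde\alpha$, where $$a=\frac{\lambda_3(\lambda_1+\lambda_4)}{\lambda_1+\lambda_4-\lambda_2}+\frac{\lambda_4(\lambda_2+\lambda_3)}{\lambda_2+\lambda_3-\lambda_1},\qquad \tilde\alpha=\left[1+\frac{\lambda_1}{\lambda_2+\lambda_3-\lambda_1}+\frac{\lambda_2}{\lambda_1+\lambda_4-\lambda_2}\right]^{-1}.$$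
   Context: Matching queue $(G,\lambda,\Phi)$ on a finite simple graph $G=(\mathcal V,\mathcal E)$ ($\mathcal E(i)$ is the set of neighbors of $i$): items of class $i\in\mathcal V$ arrive according to independent Poisson processes with intensities $\lambda_i>0$. An arriving class-$i$ item is matched immediately with exactly one queued item of some class in $\mathcal E(i)$ if there is one (both items leave at once); otherwise it is queued. $Q_i(t)$ is the number of queued class-$i$ items at time $t$. Priority policy: each $\mathcal E(i)$ is given a fixed order, and an arriving class-$i$ item is matched with an item of the first class in this order whose queue is non-empty. $Q$ is a continuous-time Markov chain on $\{z\in\mathbb Z_+^{|\mathcal V|}: z_iz_j=0\text{ for adjacent }i,j\}$; the matching queue is stable if $Q$ is positive recurrent. $\mathrm{Ncond}(G)$ is the set of $\lambda\in(0,\infty)^{|\mathcal V|}$ such that $\sum_{i\in\mathcal I}\lambda_i<\sum_{j\in\mathcal E(\mathcal I)}\lambda_j$ for every non-empty independent set $\mathcal I$ of $G$, where $\mathcal E(\mathcal I)$ is the set of nodes adjacent to some node of $\mathcal I$. *)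

theory Defs
  imports "HOL-Probability.Probability"
begin

subsection \<open>Graphs and the condition Ncond\<close>

definition simple_graph :: "'v set \<Rightarrow> 'v set set \<Rightarrow> bool" where
  "simple_graph V E \<longleftrightarrow> finite V \<and> (\<forall>e\<in>E. e \<subseteq> V \<and> card e = 2)"

definition nbrs :: "'v set set \<Rightarrow> 'v \<Rightarrow> 'v set" where
  "nbrs E i = {j. {i, j} \<in> E}"

definition independent_set :: "'v set \<Rightarrow> 'v set set \<Rightarrow> 'v set \<Rightarrow> bool" where
  "independent_set V E I \<longleftrightarrow> I \<subseteq> V \<and> (\<forall>i\<in>I. \<forall>j\<in>I. {i, j} \<notin> E)"

text \<open>Intensities are functions on the whole node type; only their values on \<open>V\<close> matter.\<close>

definition Ncond :: "'v set \<Rightarrow> 'v set set \<Rightarrow> ('v \<Rightarrow> real) set" where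
  "Ncond V E = {lam. (\<forall>i\<in>V. lam i > 0) \<and>
     (\<forall>I. independent_set V E I \<and> I \<noteq> {} \<longrightarrow>
        (\<Sum>i\<in>I. lam i) < (\<Sum>j\<in>(\<Union>i\<in>I. nbrs E i). lam j))}"

subsection \<open>Poisson arrivals\<close>

text \<open>
  \<open>N t \<omega>\<close> is the number of arrivals in \<open>(0, t]\<close>.  The truncated subtraction in the increments
  is harmless because almost all paths are nondecreasing.
\<close>

definition poisson_process :: "'w measure \<Rightarrow> real \<Rightarrow> (real \<Rightarrow> 'w \<Rightarrow> nat) \<Rightarrow> bool" where
  "poisson_process M r N \<longleftrightarrow>
     (\<forall>t\<ge>0. N t \<in> measurable M (count_space UNIV)) \<and>
     (AE \<omega> in M. N 0 \<omega> = 0 \<and> mono_on {0..} (\<lambda>t. N t \<omega>) \<and>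
        (\<forall>t\<ge>0. continuous (at_right t) (\<lambda>u. N u \<omega>))) \<and>
     (\<forall>(t :: nat \<Rightarrow> real) n. 0 \<le> t 0 \<and> incseq t \<longrightarrow>
        prob_space.indep_vars M (\<lambda>_. count_space UNIV)
          (\<lambda>k \<omega>. N (t (Suc k)) \<omega> - N (t k) \<omega>) {..<n}) \<and>
     (\<forall>s t. 0 \<le> s \<and> s < t \<longrightarrow>
        distr M (count_space UNIV) (\<lambda>\<omega>. N t \<omega> - N s \<omega>)
          = measure_pmf (poisson_pmf (r * (t - s))))"

text \<open>Independence of whole processes, as random elements of the path space.\<close>

definition indep_processes :: "'w measure \<Rightarrow> 'v set \<Rightarrow> ('v \<Rightarrow> real \<Rightarrow> 'w \<Rightarrow> nat) \<Rightarrow> bool" where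
  "indep_processes M V N \<longleftrightarrow>
     prob_space.indep_vars M (\<lambda>_. PiM {0..} (\<lambda>_. count_space UNIV))
       (\<lambda>i \<omega>. \<lambda>t\<in>{0..}. N i t \<omega>) V"

subsection \<open>Matching queues\<close>

definition queue_states :: "'v set \<Rightarrow> 'v set set \<Rightarrow> ('v \<Rightarrow> nat) set" where
  "queue_states V E =
     {z. (\<forall>i. i \<notin> V \<longrightarrow> z i = 0) \<and> (\<forall>i j. {i, j} \<in> E \<longrightarrow> z i = 0 \<or> z j = 0)}"

text \<open>\<open>Phi i\<close> lists the neighbours of \<open>i\<close>, highest priority first.\<close>

definition priority_policy :: "'v set \<Rightarrow> 'v set set \<Rightarrow> ('v \<Rightarrow> 'v list) \<Rightarrow> bool" where
  "priority_policy V E Phi \<longleftrightarrow> (\<forall>i\<in>V. distinct (Phi i) \<and> set (Phi i) = nbrs E i)"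

definition arrive :: "('v \<Rightarrow> 'v list) \<Rightarrow> 'v \<Rightarrow> ('v \<Rightarrow> nat) \<Rightarrow> ('v \<Rightarrow> nat)" where
  "arrive Phi i z =
     (case find (\<lambda>j. z j > 0) (Phi i) of
        Some j \<Rightarrow> z(j := z j - 1)
      | None \<Rightarrow> z(i := z i + 1))"

definition jumps_at :: "(real \<Rightarrow> nat) \<Rightarrow> real \<Rightarrow> bool" where
  "jumps_at a t \<longleftrightarrow> (\<forall>s\<in>{0..<t}. a s < a t)"

text \<open>
  \<open>queue_path V Phi a z q\<close>: the path \<open>q\<close> starts in \<open>z\<close>, is right-continuous and piecewise
  constant, and changes exactly at the arrival epochs of the counting paths \<open>a i\<close>, where \<open>arrive\<close>
  is applied to the state \<open>y\<close> just before the arrival.  Simultaneous arrivals of two classes (and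
  jumps of size two) have probability zero for independent Poisson processes, so the predicate
  need not resolve them; it is only required almost surely.
\<close>

definition queue_path ::
  "'v set \<Rightarrow> ('v \<Rightarrow> 'v list) \<Rightarrow> ('v \<Rightarrow> real \<Rightarrow> nat) \<Rightarrow> ('v \<Rightarrow> nat) \<Rightarrow> (real \<Rightarrow> 'v \<Rightarrow> nat) \<Rightarrow> bool"
where
  "queue_path V Phi a z q \<longleftrightarrow>
     q 0 = z \<and>
     (\<forall>t\<ge>0. \<forall>\<^sub>F u in at_right t. q u = q t) \<and>
     (\<forall>t>0. \<exists>y. (\<forall>\<^sub>F u in at_left t. q u = y) \<and>
        ((\<forall>i\<in>V. \<not> jumps_at (a i) t) \<longrightarrow> q t = y) \<and>
        (\<forall>i\<in>V. jumps_at (a i) t \<longrightarrow> q t = arrive Phi i y))"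

text \<open>
  \<open>N i\<close> counts the arrivals of class \<open>i\<close>; \<open>Q z t \<omega> i\<close> is the number of queued class-\<open>i\<close> items at
  time \<open>t\<close> when the initial state is \<open>z\<close>.
\<close>

definition matching_queue ::
  "'w measure \<Rightarrow> 'v set \<Rightarrow> 'v set set \<Rightarrow> ('v \<Rightarrow> real) \<Rightarrow> ('v \<Rightarrow> 'v list) \<Rightarrow>
   ('v \<Rightarrow> real \<Rightarrow> 'w \<Rightarrow> nat) \<Rightarrow> (('v \<Rightarrow> nat) \<Rightarrow> real \<Rightarrow> 'w \<Rightarrow> 'v \<Rightarrow> nat) \<Rightarrow> bool"
where
  "matching_queue M V E lam Phi N Q \<longleftrightarrow>
     prob_space M \<and> simple_graph V E \<and> priority_policy V E Phi \<and>
     (\<forall>i\<in>V. lam i > 0 \<and> poisson_process M (lam i) (N i)) \<and>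
     indep_processes M V N \<and>
     (\<forall>z\<in>queue_states V E.
        (\<forall>t\<ge>0. \<forall>i\<in>V. (\<lambda>\<omega>. Q z t \<omega> i) \<in> measurable M (count_space UNIV)) \<and>
        (AE \<omega> in M. queue_path V Phi (\<lambda>i t. N i t \<omega>) z (\<lambda>t. Q z t \<omega>)))"

subsection \<open>Stability\<close>

text \<open>
  The first time at which a path started in \<open>z\<close> is in \<open>z\<close> again after having left it
  (\<open>\<infinity>\<close> if there is none).
\<close>

definition return_time :: "'s \<Rightarrow> (real \<Rightarrow> 's) \<Rightarrow> ennreal" where
  "return_time z q = (INF t\<in>{t. q t = z \<and> (\<exists>s. 0 \<le> s \<and> s < t \<and> q s \<noteq> z)}. ennreal t)"

text \<open>
  \<open>X z\<close> is the chain started in \<open>z\<close>; every state must have finite mean return time.  Absorbing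
  states, which are conventionally positive recurrent, would need separate treatment, but a
  matching queue has none: every arrival changes the state.
\<close>

definition positive_recurrent :: "'w measure \<Rightarrow> 's set \<Rightarrow> ('s \<Rightarrow> real \<Rightarrow> 'w \<Rightarrow> 's) \<Rightarrow> bool" where
  "positive_recurrent M S X \<longleftrightarrow> (\<forall>z\<in>S. (\<integral>\<^sup>+ \<omega>. return_time z (\<lambda>t. X z t \<omega>) \<partial>M) < \<infinity>)"

definition stable_matching_queue ::
  "'w measure \<Rightarrow> 'v set \<Rightarrow> 'v set set \<Rightarrow> ('v \<Rightarrow> real) \<Rightarrow> ('v \<Rightarrow> 'v list) \<Rightarrow>
   ('v \<Rightarrow> real \<Rightarrow> 'w \<Rightarrow> nat) \<Rightarrow> (('v \<Rightarrow> nat) \<Rightarrow> real \<Rightarrow> 'w \<Rightarrow> 'v \<Rightarrow> nat) \<Rightarrow> bool"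
where
  "stable_matching_queue M V E lam Phi N Q \<longleftrightarrow>
     matching_queue M V E lam Phi N Q \<and> positive_recurrent M (queue_states V E) Q"

subsection \<open>The 5-cycle and its priority policy\<close>

definition cycle5_nodes :: "nat set" where
  "cycle5_nodes = {1, 2, 3, 4, 5}"

definition cycle5_edges :: "nat set set" where
  "cycle5_edges = {{1, 2}, {1, 3}, {2, 4}, {3, 5}, {4, 5}}"

definition cycle5_priority :: "nat \<Rightarrow> nat list" where
  "cycle5_priority =
     (\<lambda>_. [])(1 := [2, 3], 2 := [1, 4], 3 := [1, 5], 4 := [2, 5], 5 := [4, 3])"

lemma simple_graph_cycle5: "simple_graph cycle5_nodes cycle5_edges"
  by (auto simp: simple_graph_def cycle5_nodes_def cycle5_edges_def)

lemma priority_policy_cycle5: "priority_policy cycle5_nodes cycle5_edges cycle5_priority"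
  by (auto simp: priority_policy_def nbrs_def cycle5_nodes_def cycle5_edges_def
      cycle5_priority_def doubleton_eq_iff)

end

theory Submission
  imports Defs
begin

text \<open>
  Suppose \<open>lam 5 \<ge> a * \<alpha>\<close>.  For suitable constants \<open>A, B < 1\<close> the linear function
  \<open>f = Q\<^sub>5 - Q\<^sub>3 - Q\<^sub>4 + A Q\<^sub>1 + B Q\<^sub>2\<close> has drift exactly \<open>lam 5 - a * \<alpha>\<close> while \<open>Q\<^sub>5 > 0\<close>, at
  least that much in all other states, and positive drift in the state with a single item of class 3.
  Such a function rules out positive recurrence: over an excursion from that state back to itself
  the mean increment of \<open>f\<close> is zero, but by optional stopping it is the mean of the accumulated
  drift, which is positive.

  Optional stopping is carried out in discrete time.  Slots with exactly one arrival drive a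
  random walk with independent steps that agrees with the queue unless some slot contains two
  arrivals.  Up to time \<open>T\<close> the mean increment of \<open>f\<close> along the stopped walk is bounded below by
  a positive constant, whereas it lives on the event of no return before \<open>T\<close>, whose probability
  is \<open>o(1/T)\<close>; a second moment bound on the number of arrivals makes it vanish.
\<close>

subsection \<open>Stopped random walks with nonnegative drift\<close>

definition opt_step :: "('v \<Rightarrow> 's \<Rightarrow> 's) \<Rightarrow> 'v option \<Rightarrow> 's \<Rightarrow> 's" where
  "opt_step act x s = (case x of None \<Rightarrow> s | Some i \<Rightarrow> act i s)"

lemma opt_step_simps [simp]: "opt_step act None s = s" "opt_step act (Some i) s = act i s"
  by (simp_all add: opt_step_def)

text \<open>
  The flag \<open>l\<close> records that \<open>z\<close> has been left; the run freezes at the first return to \<open>z\<close>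
  after that.  The steps have type \<open>option\<close> because most time slots contain no arrival.
\<close>

primrec stopped_run ::
  "('v \<Rightarrow> 's \<Rightarrow> 's) \<Rightarrow> 's \<Rightarrow> bool \<Rightarrow> 's \<Rightarrow> 'v option list \<Rightarrow> 's"
where
  "stopped_run act z l s [] = s"
| "stopped_run act z l s (x # xs) =
     (if l \<and> s = z then z else stopped_run act z (l \<or> s \<noteq> z) (opt_step act x s) xs)"

lemma stopped_run_frozen [simp]: "stopped_run act z True z xs = z"
  by (cases xs) simp_all

definition num_steps :: "'v option list \<Rightarrow> nat" where
  "num_steps xs = length (filter (\<lambda>x. x \<noteq> None) xs)"

lemma num_steps_simps [simp]:
  "num_steps [] = 0" "num_steps (None # xs) = num_steps xs"
  "num_steps (Some i # xs) = Suc (num_steps xs)"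
  by (simp_all add: num_steps_def)

text \<open>The run freezes at its first return, which happens no later than index \<open>k\<close>.
  The lemma serves in contrapositive form: a run that does not end in \<open>z\<close> has not
  returned to \<open>z\<close> at any index of the list.\<close>

lemma stopped_run_returned:
  assumes "k \<le> length xs" "l \<or> (\<exists>j\<le>k. fold (opt_step act) (take j xs) s \<noteq> z)"
    and "fold (opt_step act) (take k xs) s = z"
  shows "stopped_run act z l s xs = z"
  using assms
proof (induction xs arbitrary: k l s)
  case (Cons x xs)
  show ?case
  proof (cases "l \<and> s = z")
    case False
    from False Cons.prems obtain k' where k: "k = Suc k'" by (cases k) auto
    have "l \<or> s \<noteq> z \<or> (\<exists>j\<le>k'. fold (opt_step act) (take j xs) (opt_step act x s) \<noteq> z)"
    proof (rule ccontr)
      assume neg: "\<not> ?thesis"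
      with Cons.prems(2) obtain j where j: "j \<le> k" "fold (opt_step act) (take j (x # xs)) s \<noteq> z"
        by auto
      with neg k show False by (cases j) auto
    qed
    with Cons.IH[of k' "l \<or> s \<noteq> z" "opt_step act x s"] Cons.prems False k show ?thesis by auto
  qed simp
qed auto

text \<open>The assumption \<open>drift\<close> makes \<open>f\<close> a submartingale along the
  walk with independent steps of law \<open>p\<close>. The finite support of \<open>p\<close> turns
  all expectations into finite sums.\<close>

locale random_steps =
  fixes V :: "'v set" and p :: "'v option pmf" and act :: "'v \<Rightarrow> 's \<Rightarrow> 's"
    and S :: "'s set" and f :: "'s \<Rightarrow> real" and C :: real
  assumes finite_V: "finite V"
    and set_p: "set_pmf p \<subseteq> insert None (Some ` V)"
    and act_closed: "\<And>i s. i \<in> V \<Longrightarrow> s \<in> S \<Longrightarrow> act i s \<in> S"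
    and C_nonneg: "0 \<le> C"
    and f_step: "\<And>i s. i \<in> V \<Longrightarrow> s \<in> S \<Longrightarrow> \<bar>f (act i s) - f s\<bar> \<le> C"
    and drift: "\<And>s. s \<in> S \<Longrightarrow> 0 \<le> (\<Sum>i\<in>V. pmf p (Some i) * (f (act i s) - f s))"
begin

abbreviation "expect n \<equiv> measure_pmf.expectation (replicate_pmf n p)"
abbreviation "\<theta> \<equiv> (\<Sum>i\<in>V. pmf p (Some i))"

lemma finite_set_p: "finite (set_pmf p)"
  using set_p finite_V finite_subset by blast

lemma finite_set_replicate: "finite (set_pmf (replicate_pmf n p))"
proof -
  have "set_pmf (replicate_pmf n p) \<subseteq> {xs. set xs \<subseteq> set_pmf p \<and> length xs = n}"
    by (auto simp: set_replicate_pmf lists_eq_set)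
  then show ?thesis using finite_lists_length_eq[OF finite_set_p] finite_subset by blast
qed

lemma integrable_replicate: "integrable (measure_pmf (replicate_pmf n p)) (g :: _ \<Rightarrow> real)"
  by (rule integrable_measure_pmf_finite[OF finite_set_replicate])

lemma pmf_None: "pmf p None = 1 - \<theta>"
proof -
  have "(\<Sum>x\<in>insert None (Some ` V). pmf p x) = 1"
    using set_p finite_V by (intro sum_pmf_eq_1) auto
  then show ?thesis using finite_V by (simp add: sum.reindex)
qed

lemma \<theta>_bounds: "0 \<le> \<theta>" "\<theta> \<le> 1"
  using pmf_nonneg[of p None] pmf_None by (auto intro!: sum_nonneg)

lemma expect_0: "expect 0 g = g []" for g :: "_ \<Rightarrow> real"
  by (simp add: expectation_return_pmf)

text \<open>Conditioning on the first step; the inductions on \<open>n\<close> below rest on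
  it.\<close>

lemma expect_Suc:
  fixes g :: "_ \<Rightarrow> real"
  shows "expect (Suc n) g = (1 - \<theta>) * expect n (\<lambda>xs. g (None # xs))
           + (\<Sum>i\<in>V. pmf p (Some i) * expect n (\<lambda>xs. g (Some i # xs)))"
proof -
  have "replicate_pmf (Suc n) p = p \<bind> (\<lambda>x. map_pmf ((#) x) (replicate_pmf n p))"
    by (simp add: map_pmf_def)
  then have "expect (Suc n) g = (\<Sum>x\<in>insert None (Some ` V). pmf p x *\<^sub>R
      measure_pmf.expectation (map_pmf ((#) x) (replicate_pmf n p)) g)"
    using finite_V set_p finite_set_replicate by (simp only:) (intro pmf_expectation_bind; simp)
  then show ?thesis using finite_V by (simp add: sum.reindex pmf_None)
qed

text \<open>Optional stopping: until the run freezes, each step has nonnegative mean gain by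
  \<open>drift\<close>; afterwards nothing changes.\<close>

lemma expect_stopped_run_ge: "s \<in> S \<Longrightarrow> f s \<le> expect n (\<lambda>xs. f (stopped_run act z l s xs))"
proof (induction n arbitrary: l s)
  case (Suc n)
  show ?case
  proof (cases "l \<and> s = z")
    case False
    have "f s \<le> f s + (\<Sum>i\<in>V. pmf p (Some i) * (f (act i s) - f s))"
      using drift[OF Suc.prems] by simp
    also have "\<dots> = (1 - \<theta>) * f s + (\<Sum>i\<in>V. pmf p (Some i) * f (act i s))"
      by (simp add: algebra_simps sum_subtractf sum_distrib_left)
    also have "\<dots> \<le> expect (Suc n) (\<lambda>xs. f (stopped_run act z l s xs))"
      unfolding expect_Suc using Suc.prems False \<theta>_bounds act_closed Suc.IH
      by (auto intro!: add_mono mult_left_mono sum_mono)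
    finally show ?thesis .
  qed (simp del: replicate_pmf.simps)
qed (simp add: expect_0)

text \<open>Until the first actual step the walk sits at \<open>z\<close> with the flag unset, and
  slot \<open>j\<close> is reached in this way with probability \<open>(1 - \<theta>) ^ j\<close>.
  Each such slot adds the drift at \<open>z\<close>; by \<open>expect_stopped_run_ge\<close> nothing
  is lost on average after that step.\<close>

lemma expect_stopped_run_gain:
  assumes "z \<in> S"
  shows "f z + (\<Sum>i\<in>V. pmf p (Some i) * (f (act i z) - f z)) * (\<Sum>j<n. (1 - \<theta>) ^ j)
           \<le> expect n (\<lambda>xs. f (stopped_run act z False z xs))"
proof (induction n)
  case (Suc n)
  let ?D = "\<Sum>i\<in>V. pmf p (Some i) * (f (act i z) - f z)"
  have "f z + ?D * (\<Sum>j<Suc n. (1 - \<theta>) ^ j)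
      = (1 - \<theta>) * (f z + ?D * (\<Sum>j<n. (1 - \<theta>) ^ j)) + (\<Sum>i\<in>V. pmf p (Some i) * f (act i z))"
  proof -
    have "(\<Sum>j<Suc n. (1 - \<theta>) ^ j) = 1 + (1 - \<theta>) * (\<Sum>j<n. (1 - \<theta>) ^ j)"
      by (simp add: sum.lessThan_Suc_shift sum_distrib_left del: sum.lessThan_Suc)
    moreover have "?D = (\<Sum>i\<in>V. pmf p (Some i) * f (act i z)) - \<theta> * f z"
      by (simp add: algebra_simps sum_subtractf sum_distrib_left)
    ultimately show ?thesis by (simp only:) (simp add: algebra_simps)
  qed
  also have "\<dots> \<le> expect (Suc n) (\<lambda>xs. f (stopped_run act z False z xs))"
    unfolding expect_Suc using assms \<theta>_bounds act_closed expect_stopped_run_ge Suc.IH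
    by (auto intro!: add_mono mult_left_mono sum_mono)
  finally show ?case .
qed (simp add: expect_0)

lemma stopped_run_diff_le:
  "s \<in> S \<Longrightarrow> set xs \<subseteq> insert None (Some ` V) \<Longrightarrow>
    \<bar>f (stopped_run act z l s xs) - f s\<bar> \<le> C * num_steps xs"
proof (induction xs arbitrary: l s)
  case (Cons x xs)
  show ?case
  proof (cases "l \<and> s = z")
    case True
    then show ?thesis
      using C_nonneg by simp
  next
    case False
    show ?thesis
    proof (cases x)
      case None
      with Cons False show ?thesis by auto
    next
      case (Some i)
      with Cons.prems have i: "i \<in> V" by auto
      have "\<bar>f (stopped_run act z (l \<or> s \<noteq> z) (act i s) xs) - f (act i s)\<bar> \<le> C * num_steps xs"
        using Cons.IH[of "act i s"] Cons.prems act_closed[OF i] by auto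
      with False Some f_step[OF i Cons.prems(1)] show ?thesis by (simp add: algebra_simps)
    qed
  qed
qed simp

section \<open>Moments of the number of steps and the resulting bound on the stopped walk\<close>

lemma expect_linear:
  fixes g h :: "_ \<Rightarrow> real"
  shows "expect n (\<lambda>xs. g xs + h xs) = expect n g + expect n h"
    and "expect n (\<lambda>xs. c * g xs) = c * expect n g"
    and "expect n (\<lambda>xs. g xs - h xs) = expect n g - expect n h"
  by (simp_all add: integrable_replicate)

lemma num_steps_mean: "expect n (\<lambda>xs. real (num_steps xs)) = n * \<theta>"
proof (induction n)
  case (Suc n)
  then show ?case
    by (simp add: expect_Suc expect_linear algebra_simps sum.distrib
        del: replicate_pmf.simps flip: sum_distrib_left sum_distrib_right)
qed (simp add: expect_0)

text \<open>This is the binomial variance. A shift of the centred count by \<open>c\<close> adds the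
  square of \<open>c\<close> to its second moment, and the shifts \<open>- \<theta>\<close> and
  \<open>1 - \<theta>\<close>, with weights \<open>1 - \<theta>\<close> and \<open>\<theta>\<close>,
  add \<open>\<theta> * (1 - \<theta>)\<close>.\<close>

lemma num_steps_variance:
  "expect n (\<lambda>xs. (real (num_steps xs) - n * \<theta>)\<^sup>2) = n * (\<theta> * (1 - \<theta>))"
proof (induction n)
  case (Suc n)
  let ?J = "\<lambda>xs. real (num_steps xs) - n * \<theta>"
  have m: "expect n ?J = 0" by (simp add: expect_linear num_steps_mean)
  have shift: "expect n (\<lambda>xs. (?J xs + c)\<^sup>2) = expect n (\<lambda>xs. (?J xs)\<^sup>2) + c\<^sup>2" for c
  proof -
    have "expect n (\<lambda>xs. (?J xs + c)\<^sup>2) = expect n (\<lambda>xs. (?J xs)\<^sup>2 + (2 * c) * ?J xs + c\<^sup>2)"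
      by (simp add: power2_eq_square algebra_simps)
    also have "\<dots> = expect n (\<lambda>xs. (?J xs)\<^sup>2) + (2 * c) * expect n ?J + c\<^sup>2"
      by (simp add: expect_linear(1,2))
    finally show ?thesis by (simp add: m)
  qed
  have "expect (Suc n) (\<lambda>xs. (real (num_steps xs) - Suc n * \<theta>)\<^sup>2) =
     (1 - \<theta>) * expect n (\<lambda>xs. (?J xs + (- \<theta>))\<^sup>2) + \<theta> * expect n (\<lambda>xs. (?J xs + (1 - \<theta>))\<^sup>2)"
    by (simp add: expect_Suc sum_distrib_right algebra_simps del: replicate_pmf.simps)
  also have "\<dots> = Suc n * (\<theta> * (1 - \<theta>))"
    unfolding shift Suc.IH by (simp add: power2_eq_square algebra_simps)
  finally show ?case .
qed (simp add: expect_0)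

text \<open>
  On the event \<open>A\<close> that the walk is displaced, \<open>J 1\<^sub>A \<le> (J - m)\<^sup>2 / c + (m + c) 1\<^sub>A\<close> for the
  number \<open>J\<close> of steps with mean \<open>m\<close>.
\<close>

lemma stopped_run_bound:
  assumes "z \<in> S" "0 < c"
  shows "(\<Sum>i\<in>V. pmf p (Some i) * (f (act i z) - f z)) * (\<Sum>j<n. (1 - \<theta>) ^ j)
    \<le> C * (n * \<theta> / c + (n * \<theta> + c) *
        measure_pmf.prob (replicate_pmf n p) {xs. stopped_run act z False z xs \<noteq> z})"
proof -
  let ?A = "{xs. stopped_run act z False z xs \<noteq> z}"
  let ?m = "n * \<theta>"
  have pointwise: "f (stopped_run act z False z xs) - f z
      \<le> C * ((real (num_steps xs) - ?m)\<^sup>2 / c + (?m + c) * indicator ?A xs)"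
    if xs: "xs \<in> set_pmf (replicate_pmf n p)" for xs
  proof (cases "xs \<in> ?A")
    case True
    let ?x = "real (num_steps xs) - ?m"
    have "?x \<le> ?x\<^sup>2 / c + c"
    proof -
      have "0 \<le> (?x - c)\<^sup>2 + ?x\<^sup>2 + c\<^sup>2" by simp
      then have "2 * (?x * c) \<le> 2 * (?x\<^sup>2 + c * c)" 
        by (simp add: power2_eq_square algebra_simps)
      then show ?thesis using assms(2) by (simp add: field_simps)
    qed
    then have "num_steps xs \<le> ?x\<^sup>2 / c + (?m + c)" by simp
    then have "C * num_steps xs \<le> C * (?x\<^sup>2 / c + (?m + c))"
      using C_nonneg by (intro mult_left_mono)
    moreover have "f (stopped_run act z False z xs) - f z \<le> C * num_steps xs"
    proof -
      have "set xs \<subseteq> insert None (Some ` V)"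
        using xs set_p by (auto simp: set_replicate_pmf lists_eq_set)
      from stopped_run_diff_le[OF assms(1) this, of z False] show ?thesis by simp
    qed
    ultimately show ?thesis using True by simp
  next
    \<comment> \<open>Off the event the run ends in \<open>z\<close>, so the left side is
      zero.\<close>
    case False
    then show ?thesis using assms(2) C_nonneg by simp
  qed
  have "(\<Sum>i\<in>V. pmf p (Some i) * (f (act i z) - f z)) * (\<Sum>j<n. (1 - \<theta>) ^ j)
      \<le> expect n (\<lambda>xs. f (stopped_run act z False z xs) - f z)"
    using expect_stopped_run_gain[OF assms(1), of n] by (simp add: expect_linear(3))
  also have "\<dots> \<le> expect n (\<lambda>xs. C * ((real (num_steps xs) - ?m)\<^sup>2 / c + (?m + c) * indicator ?A xs))"
    by (intro integral_mono_AE integrable_replicate) (auto simp: AE_measure_pmf_iff pointwise)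
  also have "\<dots> = C * (expect n (\<lambda>xs. (real (num_steps xs) - ?m)\<^sup>2) / c + (?m + c) *
      measure_pmf.prob (replicate_pmf n p) ?A)"
    by (simp add: integrable_replicate)
  also have "\<dots> \<le> C * (?m / c + (?m + c) * measure_pmf.prob (replicate_pmf n p) ?A)"
  proof -
    have "\<theta> * (1 - \<theta>) \<le> \<theta>" using \<theta>_bounds by (simp add: mult_left_le)
    then have "n * (\<theta> * (1 - \<theta>)) / c \<le> ?m / c"
      using assms(2) by (intro divide_right_mono mult_left_mono) auto
    then show ?thesis unfolding num_steps_variance
      using C_nonneg by (simp add: mult_left_mono)
  qed
  finally show ?thesis .
qed

end

subsection \<open>Queue paths on a time grid\<close>

text \<open>A locally constant function on a connected set is constant. At the two endpoints only
  the side facing the interval matters.\<close>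

lemma const_on_interval:
  fixes q :: "real \<Rightarrow> 's"
  assumes right: "\<forall>t\<in>{s..<u}. \<forall>\<^sub>F v in at_right t. q v = q t"
    and left: "\<forall>t\<in>{s<..u}. \<forall>\<^sub>F v in at_left t. q v = q t"
    and "t \<in> {s..u}"
  shows "q t = q s"
proof (rule connected_local_const[where A="{s..u}"])
  show "\<forall>a\<in>{s..u}. \<forall>\<^sub>F b in at a within {s..u}. q a = q b"
  proof
    fix a assume a: "a \<in> {s..u}"
    have "\<forall>\<^sub>F b in at_left a. b \<in> {s..u} \<longrightarrow> q a = q b"
    proof (cases "a = s")
      case True
      then show ?thesis by (simp add: eventually_at_filter)
    next
      case False
      with a left have "\<forall>\<^sub>F b in at_left a. q b = q a" by auto
      then show ?thesis by eventually_elim simp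
    qed
    moreover have "\<forall>\<^sub>F b in at_right a. b \<in> {s..u} \<longrightarrow> q a = q b"
    proof (cases "a = u")
      case True
      then show ?thesis by (simp add: eventually_at_filter)
    next
      case False
      with a right have "\<forall>\<^sub>F b in at_right a. q b = q a" by auto
      then show ?thesis by eventually_elim simp
    qed
    ultimately have "\<forall>\<^sub>F b in at a. b \<in> {s..u} \<longrightarrow> q a = q b"
      by (simp add: eventually_at_split)
    then show "\<forall>\<^sub>F b in at a within {s..u}. q a = q b"
      unfolding eventually_at_filter by eventually_elim simp
  qed
qed (use assms in auto)

text \<open>The value \<open>None\<close> stands for no arrival as well as for more than one.\<close>

definition sole :: "'v set \<Rightarrow> ('v \<Rightarrow> nat) \<Rightarrow> 'v option" where
  "sole V d = (if (\<Sum>i\<in>V. d i) = 1 then Some (THE i. i \<in> V \<and> d i = 1) else None)"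

lemma sole_eq_Some_iff:
  assumes "finite V"
  shows "sole V d = Some i \<longleftrightarrow> i \<in> V \<and> d i = 1 \<and> (\<forall>j\<in>V. j \<noteq> i \<longrightarrow> d j = 0)"
proof
  assume i: "i \<in> V \<and> d i = 1 \<and> (\<forall>j\<in>V. j \<noteq> i \<longrightarrow> d j = 0)"
  then have "(\<Sum>i\<in>V. d i) = 1" unfolding sum_eq_1_iff[OF assms] by (intro bexI[of _ i]) auto
  moreover have "(THE i. i \<in> V \<and> d i = 1) = i" using i by (intro the_equality) auto
  ultimately show "sole V d = Some i" by (simp add: sole_def)
next
  assume *: "sole V d = Some i"
  then have "(\<Sum>i\<in>V. d i) = 1" by (simp add: sole_def split: if_splits)
  then obtain j where j: "j \<in> V" "d j = 1" "\<forall>i\<in>V. j \<noteq> i \<longrightarrow> d i = 0"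
    unfolding sum_eq_1_iff[OF assms] by blast
  then have "(THE i. i \<in> V \<and> d i = 1) = j" by (intro the_equality) auto
  then have "i = j" using * by (simp add: sole_def split: if_splits)
  with j show "i \<in> V \<and> d i = 1 \<and> (\<forall>j\<in>V. j \<noteq> i \<longrightarrow> d j = 0)" by simp
qed

lemma sole_eq_None_iff: "sole V d = None \<longleftrightarrow> (\<Sum>i\<in>V. d i) \<noteq> 1"
  by (simp add: sole_def)

section \<open>Deterministic queue paths driven by monotone, right-continuous counting paths\<close>

context
  fixes V :: "'v set" and Phi :: "'v \<Rightarrow> 'v list" and a :: "'v \<Rightarrow> real \<Rightarrow> nat"
    and z :: "'v \<Rightarrow> nat" and q :: "real \<Rightarrow> 'v \<Rightarrow> nat"
  assumes path: "queue_path V Phi a z q"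
    and mono: "\<And>i. i \<in> V \<Longrightarrow> mono_on {0..} (a i)"
    and right_cont: "\<And>i t. i \<in> V \<Longrightarrow> 0 \<le> t \<Longrightarrow> continuous (at_right t) (a i)"
begin

lemma queue_path_const:
  assumes "0 \<le> s" "\<And>i t. i \<in> V \<Longrightarrow> s < t \<Longrightarrow> t \<le> u \<Longrightarrow> \<not> jumps_at (a i) t" "s \<le> t" "t \<le> u"
  shows "q t = q s"
proof (rule const_on_interval[where u=u])
  show "\<forall>t\<in>{s..<u}. \<forall>\<^sub>F v in at_right t. q v = q t"
    using path assms(1) by (auto simp: queue_path_def)
  show "\<forall>t\<in>{s<..u}. \<forall>\<^sub>F v in at_left t. q v = q t"
  proof
    fix t assume t: "t \<in> {s<..u}"
    then obtain y where "\<forall>\<^sub>F v in at_left t. q v = y" "(\<forall>i\<in>V. \<not> jumps_at (a i) t) \<longrightarrow> q t = y"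
      using path assms(1) unfolding queue_path_def by (metis greaterThanAtMost_iff order_le_less_trans)
    with assms(2) t show "\<forall>\<^sub>F v in at_left t. q v = q t" by auto
  qed
qed (use assms in auto)

lemma not_jumps_at: "0 \<le> s \<Longrightarrow> s < t \<Longrightarrow> a i s = a i t \<Longrightarrow> \<not> jumps_at (a i) t"
  unfolding jumps_at_def by (metis atLeastLessThan_iff less_irrefl)

lemma not_jumps_at_between:
  assumes "i \<in> V" "0 \<le> s" "s < t" "t \<le> u" "a i s = a i u"
  shows "\<not> jumps_at (a i) t"
proof -
  have "a i s \<le> a i t" "a i t \<le> a i u"
    using mono_onD[OF mono[OF assms(1)], of s t] mono_onD[OF mono[OF assms(1)], of t u] assms by auto
  then show ?thesis using assms by (intro not_jumps_at[of s]) auto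
qed

lemma queue_path_no_arrival:
  assumes "0 \<le> s" "\<And>i. i \<in> V \<Longrightarrow> a i s = a i u" "s \<le> t" "t \<le> u"
  shows "q t = q s"
  using assms not_jumps_at_between by (intro queue_path_const[of s u]) auto

text \<open>The epoch \<open>c\<close> is the infimum of the times at which the count of class
  \<open>i\<close> has gone up. By right-continuity the count is already up at \<open>c\<close>, so
  class \<open>i\<close> jumps there; no jump occurs elsewhere in the slot, and the path is constant
  on either side.\<close>

lemma queue_path_one_arrival:
  assumes "0 \<le> s" "s \<le> u" "i \<in> V" "a i u = Suc (a i s)"
    and others: "\<And>j. j \<in> V \<Longrightarrow> j \<noteq> i \<Longrightarrow> a j s = a j u"
  obtains c where "s < c" "c \<le> u" "\<And>t. s \<le> t \<Longrightarrow> t < c \<Longrightarrow> q t = q s"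
    "\<And>t. c \<le> t \<Longrightarrow> t \<le> u \<Longrightarrow> q t = arrive Phi i (q s)"
proof -
  define c where "c = Inf {t \<in> {s..u}. a i t = Suc (a i s)}"
  have u_in: "u \<in> {t \<in> {s..u}. a i t = Suc (a i s)}" using assms by auto
  have bdd: "bdd_below {t \<in> {s..u}. a i t = Suc (a i s)}" by (auto intro: bdd_belowI[of _ s])
  have c_le: "c \<le> u" unfolding c_def using u_in bdd by (rule cInf_lower)
  have s_le: "s \<le> c" unfolding c_def using u_in by (intro cInf_greatest) auto
  have mon: "a j x \<le> a j y" if "j \<in> V" "0 \<le> x" "x \<le> y" for j x y
    using mono_onD[OF mono[OF that(1)]] that by auto
  have before: "a i t = a i s" if "s \<le> t" "t < c" for t
  proof -
    have "a i t \<noteq> Suc (a i s)"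
      using cInf_lower[OF _ bdd, of t] that c_le unfolding c_def by fastforce
    moreover have "a i s \<le> a i t" "a i t \<le> a i u"
      using mon[of i s t] mon[of i t u] that assms c_le by auto
    ultimately show ?thesis using assms(4) by auto
  qed
  have after: "a i t = Suc (a i s)" if "c < t" "t \<le> u" for t
  proof -
    have "Inf {t \<in> {s..u}. a i t = Suc (a i s)} < t" using that by (simp only: c_def)
    from cInf_lessD[OF _ this] u_in obtain r where r: "s \<le> r" "a i r = Suc (a i s)" "r < t"
      by auto
    have "a i r \<le> a i t" "a i t \<le> a i u"
      using mon[OF assms(3), of r t] mon[OF assms(3), of t u] r assms(1) that(2) by simp_all
    with r assms(4) show ?thesis by simp
  qed
  \<comment> \<open>Just to the right of \<open>c\<close> the count equals both
    \<open>a i c\<close>, by right-continuity in a discrete space, and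
    \<open>Suc (a i s)\<close>.\<close>
  have at_c: "a i c = Suc (a i s)"
  proof (cases "c = u")
    case False
    have "(a i \<longlongrightarrow> a i c) (at_right c)"
      using right_cont[of i c] assms s_le by (auto simp: continuous_within)
    then have "\<forall>\<^sub>F t in at_right c. a i t = a i c" by (simp add: tendsto_discrete)
    moreover have "\<forall>\<^sub>F t in at_right c. t \<in> {c<..<u}"
      using False c_le by (intro eventually_at_right_real) auto
    ultimately have "\<forall>\<^sub>F t in at_right c. a i c = Suc (a i s)"
      by eventually_elim (use after in auto)
    then show ?thesis by (simp add: trivial_limit_at_right_real)
  qed (use assms in simp)
  have s_less: "s < c" using at_c s_le by (cases "s = c") auto
  have no_jump_others: "\<not> jumps_at (a j) t" if "j \<in> V" "j \<noteq> i" "s < t" "t \<le> u" for j t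
    using not_jumps_at_between[of j s t u] others that assms by auto
  have q_before: "q t = q s" if "s \<le> t" "t < c" for t
  proof (rule queue_path_const[of s t])
    fix j r assume r: "j \<in> V" "s < r" "r \<le> t"
    show "\<not> jumps_at (a j) r"
    proof (cases "j = i")
      case True
      then show ?thesis using not_jumps_at_between[of i s r t] before[of t] r assms that by simp
    next
      case False
      then show ?thesis using no_jump_others[of j r] r c_le that by simp
    qed
  qed (use that assms in auto)
  have q_at: "q c = arrive Phi i (q s)"
  proof -
    have "jumps_at (a i) c" unfolding jumps_at_def
    proof
      fix t assume t: "t \<in> {0..<c}"
      show "a i t < a i c"
      proof (cases "t \<le> s")
        case True
        then have "a i t \<le> a i s" using mon[of i t s] t assms(3) by simp
        then show ?thesis using at_c by simp
      next
        case False
        then show ?thesis using before[of t] t at_c by simp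
      qed
    qed
    have "0 < c" using assms(1) s_less by simp
    then obtain y where "(\<forall>\<^sub>F v in at_left c. q v = y) \<and>
        ((\<forall>i\<in>V. \<not> jumps_at (a i) c) \<longrightarrow> q c = y) \<and>
        (\<forall>i\<in>V. jumps_at (a i) c \<longrightarrow> q c = arrive Phi i y)"
      using path unfolding queue_path_def by metis
    with \<open>jumps_at (a i) c\<close> assms(3) have y: "\<forall>\<^sub>F v in at_left c. q v = y" "q c = arrive Phi i y"
      by simp_all
    \<comment> \<open>The state \<open>y\<close> just before the arrival is \<open>q s\<close>,
      because the path is constant on \<open>{s..<c}\<close>.\<close>
    have "\<forall>\<^sub>F v in at_left c. v \<in> {s<..<c}"
      using s_less by (intro eventually_at_left_real) auto
    with y(1) have "\<forall>\<^sub>F v in at_left c. q s = y"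
    proof eventually_elim
      case (elim v)
      then show ?case using q_before[of v] by simp
    qed
    then have "q s = y" by (simp add: trivial_limit_at_left_real)
    with y show ?thesis by simp
  qed
  have q_after: "q t = arrive Phi i (q s)" if "c \<le> t" "t \<le> u" for t
  proof -
    have "q t = q c"
    proof (rule queue_path_const[of c u])
      fix j r assume "j \<in> V" "c < r" "r \<le> u"
      then show "\<not> jumps_at (a j) r"
        using not_jumps_at_between[of i c r u] at_c assms no_jump_others[of j r] s_less by (cases "j = i") auto
    qed (use that assms s_less in auto)
    then show ?thesis using q_at by simp
  qed
  show ?thesis using that s_less c_le q_before q_after by blast
qed

text \<open>Empty slots and slots with one arrival are brought to a common form. In an empty slot
  the switching time \<open>c\<close> is set to \<open>u\<close>, which is harmless because the
  state does not change.\<close>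

lemma queue_path_sparse_arrivals:
  assumes "finite V" "0 \<le> s" "s < u" and sparse: "(\<Sum>i\<in>V. a i u - a i s) \<le> 1"
  obtains c where "s < c" "c \<le> u" "\<And>t. s \<le> t \<Longrightarrow> t < c \<Longrightarrow> q t = q s"
    "\<And>t. c \<le> t \<Longrightarrow> t \<le> u \<Longrightarrow> q t = opt_step (arrive Phi) (sole V (\<lambda>i. a i u - a i s)) (q s)"
proof (cases "sole V (\<lambda>i. a i u - a i s)")
  case None
  with sparse have "(\<Sum>i\<in>V. a i u - a i s) = 0" by (simp add: sole_eq_None_iff)
  then have "a i s = a i u" if "i \<in> V" for i
    using that assms mono_onD[OF mono[OF that], of s u] by auto
  then have const: "q t = q s" if "s \<le> t" "t \<le> u" for t
    using that assms(2) by (intro queue_path_no_arrival[of s u]) auto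
  show ?thesis
  proof (rule that[of u])
    fix t assume "u \<le> t" "t \<le> u"
    with const[of t] assms(3) None
    show "q t = opt_step (arrive Phi) (sole V (\<lambda>i. a i u - a i s)) (q s)" by simp
  qed (use assms(3) in \<open>auto intro: const\<close>)
next
  case (Some i)
  then have i: "i \<in> V" "a i u - a i s = 1" "\<And>j. j \<in> V \<Longrightarrow> j \<noteq> i \<Longrightarrow> a j u - a j s = 0"
    using assms(1) by (auto simp: sole_eq_Some_iff)
  have "a j s = a j u" if "j \<in> V" "j \<noteq> i" for j
    using i(3)[OF that] assms mono_onD[OF mono[OF that(1)], of s u] by auto
  note others = this
  have "a i u = Suc (a i s)" using i(2) by simp
  from queue_path_one_arrival[OF assms(2) less_imp_le[OF assms(3)] i(1) this others]
  obtain c where c: "s < c" "c \<le> u" "\<And>t. s \<le> t \<Longrightarrow> t < c \<Longrightarrow> q t = q s"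
    "\<And>t. c \<le> t \<Longrightarrow> t \<le> u \<Longrightarrow> q t = arrive Phi i (q s)" by blast
  show ?thesis
    by (rule that[of c]) (auto simp: Some c(4) intro: c)
qed

text \<open>With at most one arrival per slot, each state visited within a slot is the grid state at
  one of its ends. Leaving and regaining \<open>z\<close> before time \<open>h * n\<close> would
  thus show on the grid and freeze the run at \<open>z\<close>.\<close>

lemma return_time_ge:
  fixes h :: real
  assumes "finite V" "0 < h"
    and sparse: "\<And>k. k < n \<Longrightarrow> (\<Sum>i\<in>V. a i (h * Suc k) - a i (h * k)) \<le> 1"
    and not_returned: "stopped_run (arrive Phi) z False z
      (map (\<lambda>k. sole V (\<lambda>i. a i (h * Suc k) - a i (h * k))) [0..<n]) \<noteq> z"
  shows "ennreal (h * n) \<le> return_time z q"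
proof -
  define xs where "xs = map (\<lambda>k. sole V (\<lambda>i. a i (h * Suc k) - a i (h * k))) [0..<n]"
  define X where "X k = fold (opt_step (arrive Phi)) (take k xs) z" for k
  have X_Suc: "X (Suc k) = opt_step (arrive Phi) (xs ! k) (X k)" if "k < n" for k
    using that by (simp add: X_def xs_def take_Suc_conv_app_nth)
  have cell: "\<exists>c. h * k < c \<and> c \<le> h * Suc k \<and> (\<forall>t. h * k \<le> t \<and> t < c \<longrightarrow> q t = q (h * k)) \<and>
      (\<forall>t. c \<le> t \<and> t \<le> h * Suc k \<longrightarrow> q t = opt_step (arrive Phi) (xs ! k) (q (h * k)))"
    if "k < n" for k
  proof -
    have "0 \<le> h * k" "h * k < h * Suc k" using assms(2) by simp_all
    from queue_path_sparse_arrivals[OF assms(1) this sparse[OF that]]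
    obtain c where "h * k < c" "c \<le> h * Suc k" "\<And>t. h * k \<le> t \<Longrightarrow> t < c \<Longrightarrow> q t = q (h * k)"
      "\<And>t. c \<le> t \<Longrightarrow> t \<le> h * Suc k \<Longrightarrow> q t = opt_step (arrive Phi)
        (sole V (\<lambda>i. a i (h * Suc k) - a i (h * k))) (q (h * k))" by blast
    moreover have "xs ! k = sole V (\<lambda>i. a i (h * Suc k) - a i (h * k))"
      using that by (simp add: xs_def)
    ultimately show ?thesis by metis
  qed
  have q_grid: "q (h * k) = X k" if "k \<le> n" for k
    using that
  proof (induction k)
    case 0
    then show ?case using path by (simp add: X_def queue_path_def)
  next
    case (Suc k)
    with cell[of k] X_Suc[of k] show ?case by auto
  qed
  have cell': "\<exists>c. h * k < c \<and> c \<le> h * Suc k \<and> (\<forall>t. h * k \<le> t \<and> t < c \<longrightarrow> q t = X k) \<and>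
      (\<forall>t. c \<le> t \<and> t \<le> h * Suc k \<longrightarrow> q t = X (Suc k))" if "k < n" for k
    using cell[OF that] by (simp only: q_grid[OF less_imp_le[OF that]] X_Suc[OF that])
  have floor_cell: "\<exists>k<n. h * k \<le> t \<and> t < h * Suc k" if "0 \<le> t" "t < h * n" for t
  proof (intro exI conjI)
    let ?k = "nat \<lfloor>t / h\<rfloor>"
    have "0 \<le> t / h" using that assms(2) by simp
    then have k: "real ?k \<le> t / h" "t / h < real ?k + 1" by linarith+
    show "h * ?k \<le> t" "t < h * Suc ?k" using k assms(2) by (simp_all add: field_simps)
    have "t / h < n" using that assms(2) by (simp add: field_simps)
    with k show "?k < n" by linarith
  qed
  have "h * n \<le> t" if t: "q t = z" "0 \<le> s" "s < t" "q s \<noteq> z" for s t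
  proof (rule ccontr)
    assume "\<not> ?thesis"
    then have tn: "t < h * n" by simp
    obtain k where k: "k < n" "h * k \<le> t" "t < h * Suc k" using floor_cell[of t] t tn by auto
    obtain j where j: "j < n" "h * j \<le> s" "s < h * Suc j" using floor_cell[of s] t tn by auto
    obtain c where c: "\<And>t. h * k \<le> t \<Longrightarrow> t < c \<Longrightarrow> q t = X k"
      "\<And>t. c \<le> t \<Longrightarrow> t \<le> h * Suc k \<Longrightarrow> q t = X (Suc k)" using cell'[OF k(1)] by blast
    obtain d where d: "\<And>t. h * j \<le> t \<Longrightarrow> t < d \<Longrightarrow> q t = X j"
      "\<And>t. d \<le> t \<Longrightarrow> t \<le> h * Suc j \<Longrightarrow> q t = X (Suc j)" using cell'[OF j(1)] by blast
    have "h * j < h * Suc k" using j k t by linarith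
    then have "j < Suc k" using assms(2) by (simp only: mult_less_cancel_left_pos of_nat_less_iff)
    \<comment> \<open>If \<open>s\<close> and \<open>t\<close> share a slot, the switching time
      separates them and the two ends of the slot serve. Otherwise \<open>l\<close> is an end of the
      slot of \<open>s\<close> and \<open>m\<close> an end of the later slot of
      \<open>t\<close>.\<close>
    have "\<exists>l m. l \<le> m \<and> m \<le> n \<and> X l \<noteq> z \<and> X m = z"
    proof (cases "j = k")
      case True
      have "q s = X k" "q t = X (Suc k)"
        using c(1)[of s] c(2)[of s] c(1)[of t] c(2)[of t] t j k True
        by (cases "s < c"; cases "t < c"; simp)+
      then show ?thesis using t k by (intro exI[of _ k] exI[of _ "Suc k"]) simp
    next
      case False
      with \<open>j < Suc k\<close> have jk: "Suc j \<le> k" by simp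
      obtain l where l: "l \<le> Suc j" "X l \<noteq> z"
        using that[of j] that[of "Suc j"] d(1)[of s] d(2)[of s] j t by (cases "s < d") simp_all
      obtain m where m: "k \<le> m" "m \<le> Suc k" "X m = z"
        using that[of k] that[of "Suc k"] c(1)[of t] c(2)[of t] k t by (cases "t < c") simp_all
      from l m jk k show ?thesis by (intro exI[of _ l] exI[of _ m]) auto
    qed
    then obtain l m where lm: "l \<le> m" "m \<le> n" "X l \<noteq> z" "X m = z" by blast
    then have "stopped_run (arrive Phi) z False z xs = z"
      by (intro stopped_run_returned[of m]) (auto simp: X_def xs_def)
    with not_returned show False by (simp add: xs_def)
  qed
  then show ?thesis unfolding return_time_def
    by (intro INF_greatest ennreal_leI) auto
qed

end

subsection \<open>Poisson arrivals on a time grid\<close>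

lemma sole_cong: "(\<And>i. i \<in> V \<Longrightarrow> d i = d' i) \<Longrightarrow> sole V d = sole V d'"
proof -
  assume eq: "\<And>i. i \<in> V \<Longrightarrow> d i = d' i"
  then have "(\<lambda>i. i \<in> V \<and> d i = 1) = (\<lambda>i. i \<in> V \<and> d' i = 1)" by auto
  with eq show ?thesis by (simp add: sole_def)
qed

lemma sole_in: "finite V \<Longrightarrow> sole V d \<in> insert None (Some ` V)"
  by (cases "sole V d") (auto simp: sole_eq_Some_iff)

lemma pmf_replicate_pmf: "pmf (replicate_pmf (length xs) p) xs = (\<Prod>x\<leftarrow>xs. pmf p x)"
proof (induction xs)
  case (Cons x xs)
  have "replicate_pmf (length (x # xs)) p =
      map_pmf (\<lambda>(x, xs). x # xs) (pair_pmf p (replicate_pmf (length xs) p))"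
    by (simp add: pair_pmf_def map_bind_pmf bind_map_pmf map_pmf_def bind_assoc_pmf bind_return_pmf)
  also have "pmf \<dots> ((\<lambda>(x, xs). x # xs) (x, xs)) = pmf p x * pmf (replicate_pmf (length xs) p) xs"
    by (subst pmf_map_inj') (auto simp: inj_def pmf_pair)
  finally show ?case using Cons by simp
qed simp

locale poisson_arrivals = prob_space M for M :: "'w measure" +
  fixes V :: "'v set" and lam :: "'v \<Rightarrow> real" and N :: "'v \<Rightarrow> real \<Rightarrow> 'w \<Rightarrow> nat" and h :: real
  assumes finite_V: "finite V" and V_nonempty: "V \<noteq> {}"
    and lam_pos: "\<And>i. i \<in> V \<Longrightarrow> 0 < lam i"
    and poisson: "\<And>i. i \<in> V \<Longrightarrow> poisson_process M (lam i) (N i)"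
    and indep: "indep_processes M V N"
    and h_pos: "0 < h"
begin

definition incr :: "'v \<Rightarrow> nat \<Rightarrow> 'w \<Rightarrow> nat" where
  "incr i k \<omega> = N i (h * Suc k) \<omega> - N i (h * k) \<omega>"

text \<open>
  Recording only slots with a single arrival makes the weights of the classes exactly
  proportional to \<open>lam\<close>, so that the drift of the discretized chain needs no error term.
\<close>

definition arrival :: "nat \<Rightarrow> 'w \<Rightarrow> 'v option" where
  "arrival k \<omega> = sole V (\<lambda>i. incr i k \<omega>)"

abbreviation "\<Lambda> \<equiv> (\<Sum>i\<in>V. lam i)"

lemma \<Lambda>_pos: "0 < \<Lambda>"
  using finite_V V_nonempty lam_pos by (intro sum_pos)

lemma N_measurable: "i \<in> V \<Longrightarrow> 0 \<le> t \<Longrightarrow> N i t \<in> measurable M (count_space UNIV)"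
  using poisson by (simp add: poisson_process_def)

lemma incr_measurable [measurable]:
  assumes "i \<in> V"
  shows "incr i k \<in> measurable M (count_space UNIV)"
proof -
  have [measurable]: "N i (h * Suc k) \<in> measurable M (count_space UNIV)"
    "N i (h * k) \<in> measurable M (count_space UNIV)"
    using assms h_pos by (auto intro!: N_measurable)
  show ?thesis unfolding incr_def [abs_def] by measurable
qed

section \<open>Joint independence of the increments over classes and slots\<close>

lemma prob_incr_path:
  assumes "i \<in> V"
  shows "prob {\<omega> \<in> space M. \<forall>k<n. incr i k \<omega> \<in> B k} = (\<Prod>k<n. prob {\<omega> \<in> space M. incr i k \<omega> \<in> B k})"
proof (cases "n = 0")
  case False
  have "incseq (\<lambda>k. h * real k)"
    using h_pos by (auto simp: incseq_def)
  then have "indep_vars (\<lambda>_. count_space UNIV) (\<lambda>k \<omega>. N i (h * Suc k) \<omega> - N i (h * k) \<omega>) {..<n}"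
    using poisson[OF assms] unfolding poisson_process_def
    by (elim conjE allE[of _ "\<lambda>k. h * real k"]) simp
  then have "indep_vars (\<lambda>_. count_space UNIV) (incr i) {..<n}"
    by (simp add: incr_def [abs_def])
  from indep_varsD_finite[OF this, of B] False
  have "prob (\<Inter>k<n. incr i k -` B k \<inter> space M) = (\<Prod>k<n. prob (incr i k -` B k \<inter> space M))"
    by auto
  also have "(\<Inter>k<n. incr i k -` B k \<inter> space M) = {\<omega> \<in> space M. \<forall>k<n. incr i k \<omega> \<in> B k}"
    using False by auto
  finally show ?thesis by (simp add: vimage_def Int_def conj_commute)
qed (simp add: prob_space)

text \<open>Classes are independent as whole paths, and the event for one class depends on finitely
  many coordinates, hence is measurable in path space. Independent increments then factor the
  probability for each class.\<close>

lemma prob_incr_grid: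
  "prob {\<omega> \<in> space M. \<forall>i\<in>V. \<forall>k<n. incr i k \<omega> \<in> B i k} =
    (\<Prod>i\<in>V. \<Prod>k<n. prob {\<omega> \<in> space M. incr i k \<omega> \<in> B i k})"
proof -
  let ?P = "PiM {0::real..} (\<lambda>_. count_space (UNIV :: nat set))"
  let ?path = "\<lambda>i \<omega>. \<lambda>t\<in>{0..}. N i t \<omega>"
  define A where "A i = {x \<in> space ?P. \<forall>k<n. x (h * Suc k) - x (h * k) \<in> B i k}" for i
  have A: "A i \<in> sets ?P" for i
  proof -
    have [measurable]: "(\<lambda>x. x (h * k)) \<in> measurable ?P (count_space UNIV)" for k :: nat
      using h_pos by (intro measurable_component_singleton) auto
    show ?thesis unfolding A_def by measurable
  qed
  have vimage: "?path i -` A i \<inter> space M = {\<omega> \<in> space M. \<forall>k<n. incr i k \<omega> \<in> B i k}" for i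
    using h_pos by (auto simp: A_def incr_def space_PiM)
  have "indep_vars (\<lambda>_. ?P) ?path V"
    using indep by (simp add: indep_processes_def)
  from indep_varsD_finite[where A=A, OF this V_nonempty finite_V A]
  have "prob (\<Inter>i\<in>V. {\<omega> \<in> space M. \<forall>k<n. incr i k \<omega> \<in> B i k}) =
      (\<Prod>i\<in>V. prob {\<omega> \<in> space M. \<forall>k<n. incr i k \<omega> \<in> B i k})"
    by (simp only: vimage)
  also have "(\<Inter>i\<in>V. {\<omega> \<in> space M. \<forall>k<n. incr i k \<omega> \<in> B i k}) =
      {\<omega> \<in> space M. \<forall>i\<in>V. \<forall>k<n. incr i k \<omega> \<in> B i k}"
    using V_nonempty by auto
  finally show ?thesis by (simp add: prob_incr_path)
qed

text \<open>For arbitrary target sets, \<open>prob_incr_grid\<close> is the product formula that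
  characterizes independence of a finite family.\<close>

lemma indep_vars_incr:
  "indep_vars (\<lambda>_. count_space UNIV) (\<lambda>(i, k). incr i k) (V \<times> {..<n})"
proof (cases "n = 0")
  case True
  then show ?thesis by (simp add: indep_vars_def indep_sets_def)
next
  case False
  let ?F = "\<lambda>x. {(case x of (i, k) \<Rightarrow> incr i k) -` B \<inter> space M | B. B \<in> sets (count_space UNIV)}"
  have "indep_sets ?F (V \<times> {..<n})"
  proof (subst indep_sets_finite)
    show "\<forall>A\<in>Pi (V \<times> {..<n}) ?F. prob (\<Inter>x\<in>V \<times> {..<n}. A x) = (\<Prod>x\<in>V \<times> {..<n}. prob (A x))"
    proof
      fix A assume "A \<in> Pi (V \<times> {..<n}) ?F"
      then have "\<forall>x\<in>V \<times> {..<n}. \<exists>B. A x = (case x of (i, k) \<Rightarrow> incr i k) -` B \<inter> space M"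
        by (auto simp: Pi_iff)
      from bchoice[OF this] obtain B where
        B: "\<And>x. x \<in> V \<times> {..<n} \<Longrightarrow> A x = (case x of (i, k) \<Rightarrow> incr i k) -` B x \<inter> space M"
        by blast
      have A: "A (i, k) = {\<omega> \<in> space M. incr i k \<omega> \<in> B (i, k)}" if "i \<in> V" "k < n" for i k
        using B[of "(i, k)"] that by auto
      have "(\<Inter>x\<in>V \<times> {..<n}. A x) = {\<omega> \<in> space M. \<forall>i\<in>V. \<forall>k<n. incr i k \<omega> \<in> B (i, k)}"
        using A V_nonempty False by auto
      then have "prob (\<Inter>x\<in>V \<times> {..<n}. A x) =
          (\<Prod>i\<in>V. \<Prod>k<n. prob {\<omega> \<in> space M. incr i k \<omega> \<in> B (i, k)})"
        by (simp only: prob_incr_grid)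
      also have "\<dots> = (\<Prod>i\<in>V. \<Prod>k<n. prob (A (i, k)))"
        using A by (intro prod.cong) auto
      finally show "prob (\<Inter>x\<in>V \<times> {..<n}. A x) = (\<Prod>x\<in>V \<times> {..<n}. prob (A x))"
        by (simp add: prod.cartesian_product)
    qed
  next
    fix x assume x: "x \<in> V \<times> {..<n}"
    then show "?F x \<subseteq> events" by (auto intro: measurable_sets[OF incr_measurable])
    show "space M \<in> ?F x" by (auto intro!: exI[of _ UNIV])
  qed (use V_nonempty False finite_V in auto)
  then show ?thesis by (auto simp: indep_vars_def2)
qed

text \<open>Slot \<open>k\<close> uses only the block \<open>V \<times> {k}\<close> of increments,
  and functions of disjoint blocks of an independent family are independent. Measurability is part
  of the independence statement.\<close>

lemma arrival_measurable [measurable]: "arrival k \<in> measurable M (count_space UNIV)"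
  and indep_vars_arrival: "indep_vars (\<lambda>_. count_space UNIV) arrival {..<n}"
proof -
  have *: "indep_vars (\<lambda>_. count_space UNIV) arrival {..<n}" for n
  proof -
    let ?P = "\<lambda>k. PiM (V \<times> {k}) (\<lambda>_. count_space (UNIV :: nat set))"
    have "indep_vars ?P (\<lambda>k \<omega>. restrict (\<lambda>x. (case x of (i, k) \<Rightarrow> incr i k) \<omega>) (V \<times> {k})) {..<n}"
      by (rule indep_vars_restrict[OF indep_vars_incr]) (auto simp: disjoint_family_on_def)
    then have "indep_vars (\<lambda>_. count_space UNIV) (\<lambda>k \<omega>. sole V (\<lambda>i.
        restrict (\<lambda>x. (case x of (i, k) \<Rightarrow> incr i k) \<omega>) (V \<times> {k}) (i, k))) {..<n}"
    proof (rule indep_vars_compose2[where Y="\<lambda>k r. sole V (\<lambda>i. r (i, k))"])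
      fix k
      show "(\<lambda>r. sole V (\<lambda>i. r (i, k))) \<in> measurable (?P k) (count_space UNIV)"
        using finite_V by (subst count_space_PiM_finite) auto
    qed
    moreover have "(\<lambda>k \<omega>. sole V (\<lambda>i.
        restrict (\<lambda>x. (case x of (i, k) \<Rightarrow> incr i k) \<omega>) (V \<times> {k}) (i, k))) = arrival"
      by (auto simp: arrival_def fun_eq_iff intro!: sole_cong)
    ultimately show ?thesis by simp
  qed
  then show "indep_vars (\<lambda>_. count_space UNIV) arrival {..<n}" .
  show "arrival k \<in> measurable M (count_space UNIV)"
    using *[of "Suc k"] by (simp add: indep_vars_def)
qed

section \<open>The distribution of the arrivals in a slot\<close>

lemma prob_incr_eq:
  "prob {\<omega> \<in> space M. \<forall>i\<in>V. incr i k \<omega> = d i}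
    = (\<Prod>i\<in>V. (lam i * h) ^ d i / fact (d i)) * exp (- \<Lambda> * h)"
proof -
  have incr: "prob {\<omega> \<in> space M. incr i k \<omega> = m} = (lam i * h) ^ m / fact m * exp (- (lam i * h))"
    if "i \<in> V" for i m
  proof -
    have "distr M (count_space UNIV) (\<lambda>\<omega>. N i (h * Suc k) \<omega> - N i (h * k) \<omega>)
        = measure_pmf (poisson_pmf (lam i * (h * Suc k - h * k)))"
      using poisson[OF that] h_pos unfolding poisson_process_def by simp
    then have "distr M (count_space UNIV) (incr i k) = measure_pmf (poisson_pmf (lam i * h))"
      by (simp add: incr_def [abs_def] algebra_simps)
    then have "measure (distr M (count_space UNIV) (incr i k)) {m} = pmf (poisson_pmf (lam i * h)) m"
      by (simp add: measure_pmf_single)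
    then show ?thesis
      using that lam_pos h_pos
      by (simp add: measure_distr vimage_def Int_def conj_commute)
  qed
  \<comment> \<open>The target \<open>UNIV\<close> leaves the other slots unconstrained, so the grid
    formula yields the law of a single slot.\<close>
  have "{\<omega> \<in> space M. \<forall>i\<in>V. incr i k \<omega> = d i} =
      {\<omega> \<in> space M. \<forall>i\<in>V. \<forall>l<Suc k. incr i l \<omega> \<in> (if l = k then {d i} else UNIV)}"
    by (auto split: if_splits)
  then have "prob {\<omega> \<in> space M. \<forall>i\<in>V. incr i k \<omega> = d i} =
     (\<Prod>i\<in>V. \<Prod>l<Suc k. prob {\<omega> \<in> space M. incr i l \<omega> \<in> (if l = k then {d i} else UNIV)})"
    by (simp only: prob_incr_grid)
  also have "\<dots> = (\<Prod>i\<in>V. prob {\<omega> \<in> space M. incr i k \<omega> = d i})"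
    by (intro prod.cong) (simp_all add: prob_space)
  also have "\<dots> = (\<Prod>i\<in>V. (lam i * h) ^ d i / fact (d i) * exp (- (lam i * h)))"
    by (intro prod.cong) (simp_all add: incr)
  also have "\<dots> = (\<Prod>i\<in>V. (lam i * h) ^ d i / fact (d i)) * exp (- \<Lambda> * h)"
    unfolding prod.distrib using finite_V
    by (simp add: exp_sum sum_distrib_right flip: sum_negf)
  finally show ?thesis .
qed

lemma prob_arrival_Some:
  assumes "i \<in> V"
  shows "prob {\<omega> \<in> space M. arrival k \<omega> = Some i} = lam i * h * exp (- \<Lambda> * h)"
proof -
  have "{\<omega> \<in> space M. arrival k \<omega> = Some i} = {\<omega> \<in> space M. \<forall>j\<in>V. incr j k \<omega> = (if j = i then 1 else 0)}"
    using assms finite_V by (auto simp: arrival_def sole_eq_Some_iff split: if_splits)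
  moreover have "(\<Prod>j\<in>V. (lam j * h) ^ (if j = i then 1 else 0) / fact (if j = i then 1 else 0)) = lam i * h"
  proof -
    have "(\<Prod>j\<in>V. (lam j * h) ^ (if j = i then 1 else 0) / fact (if j = i then 1 else 0)) =
        (\<Prod>j\<in>V. if j = i then lam j * h else 1)"
      by (intro prod.cong) auto
    then show ?thesis using assms finite_V by simp
  qed
  ultimately show ?thesis by (simp only: prob_incr_eq)
qed

text \<open>With \<open>x = \<Lambda> * h\<close>, at most one arrival has probability
  \<open>exp (- x) * (1 + x)\<close>, which is at least \<open>(1 - x) * (1 + x)\<close>.\<close>

lemma prob_crowded: "prob {\<omega> \<in> space M. \<not> (\<Sum>i\<in>V. incr i k \<omega>) \<le> 1} \<le> (\<Lambda> * h)\<^sup>2"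
proof -
  let ?e = "exp (- \<Lambda> * h)"
  have meas [measurable]: "(\<lambda>\<omega>. \<Sum>i\<in>V. incr i k \<omega>) \<in> measurable M (count_space UNIV)"
    by measurable
  have "{\<omega> \<in> space M. (\<Sum>i\<in>V. incr i k \<omega>) \<le> 1} =
      {\<omega> \<in> space M. \<forall>i\<in>V. incr i k \<omega> = 0} \<union> (\<Union>i\<in>V. {\<omega> \<in> space M. arrival k \<omega> = Some i})"
  proof -
    have "(\<Sum>i\<in>V. incr i k \<omega>) = 1 \<longleftrightarrow> (\<exists>i\<in>V. arrival k \<omega> = Some i)" for \<omega>
      using sole_in[OF finite_V, of "\<lambda>i. incr i k \<omega>"] sole_eq_None_iff[of V "\<lambda>i. incr i k \<omega>"]
      unfolding arrival_def by (metis (no_types, lifting) imageE insertE option.distinct(1))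
    moreover have "(\<Sum>i\<in>V. incr i k \<omega>) = 0 \<longleftrightarrow> (\<forall>i\<in>V. incr i k \<omega> = 0)" for \<omega>
      using finite_V by simp
    moreover have "m \<le> 1 \<longleftrightarrow> m = 0 \<or> m = 1" for m :: nat by auto
    ultimately show ?thesis by auto
  qed
  also have "prob \<dots> = prob {\<omega> \<in> space M. \<forall>i\<in>V. incr i k \<omega> = 0} +
      prob (\<Union>i\<in>V. {\<omega> \<in> space M. arrival k \<omega> = Some i})"
    using finite_V by (intro finite_measure_Union) (auto simp: arrival_def sole_eq_Some_iff)
  also have "prob (\<Union>i\<in>V. {\<omega> \<in> space M. arrival k \<omega> = Some i}) =
      (\<Sum>i\<in>V. prob {\<omega> \<in> space M. arrival k \<omega> = Some i})"
    using finite_V by (intro finite_measure_finite_Union) (auto simp: disjoint_family_on_def)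
  also have "\<dots> = \<Lambda> * h * ?e"
    by (simp add: prob_arrival_Some sum_distrib_right)
  also have "prob {\<omega> \<in> space M. \<forall>i\<in>V. incr i k \<omega> = 0} = ?e"
    by (simp add: prob_incr_eq)
  finally have "prob {\<omega> \<in> space M. (\<Sum>i\<in>V. incr i k \<omega>) \<le> 1} = ?e * (1 + \<Lambda> * h)"
    by (simp add: algebra_simps)
  moreover have "(1 - \<Lambda> * h) * (1 + \<Lambda> * h) \<le> ?e * (1 + \<Lambda> * h)"
    using exp_ge_add_one_self[of "- \<Lambda> * h"] \<Lambda>_pos h_pos by (intro mult_right_mono) auto
  moreover have "prob {\<omega> \<in> space M. \<not> (\<Sum>i\<in>V. incr i k \<omega>) \<le> 1} =
      1 - prob {\<omega> \<in> space M. (\<Sum>i\<in>V. incr i k \<omega>) \<le> 1}"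
    by (rule prob_neg) measurable
  ultimately show ?thesis by (simp add: power2_eq_square algebra_simps)
qed

lemma prob_some_crowded:
  "prob {\<omega> \<in> space M. \<not> (\<forall>k<n. (\<Sum>i\<in>V. incr i k \<omega>) \<le> 1)} \<le> real n * (\<Lambda> * h)\<^sup>2"
proof -
  have meas [measurable]: "(\<lambda>\<omega>. \<Sum>i\<in>V. incr i k \<omega>) \<in> measurable M (count_space UNIV)" for k
    by measurable
  have "{\<omega> \<in> space M. \<not> (\<forall>k<n. (\<Sum>i\<in>V. incr i k \<omega>) \<le> 1)} =
      (\<Union>k<n. {\<omega> \<in> space M. \<not> (\<Sum>i\<in>V. incr i k \<omega>) \<le> 1})" by auto
  also have "prob \<dots> \<le> (\<Sum>k<n. prob {\<omega> \<in> space M. \<not> (\<Sum>i\<in>V. incr i k \<omega>) \<le> 1})"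
    by (intro finite_measure_subadditive_finite) auto
  also have "\<dots> \<le> (\<Sum>k<n. (\<Lambda> * h)\<^sup>2)" by (intro sum_mono prob_crowded)
  finally show ?thesis by simp
qed

text \<open>All slots have the same law: the weight of \<open>Some i\<close> is explicit, and the
  weight of \<open>None\<close> is its complement.\<close>

lemma arrival_pmf_exists:
  obtains p where "set_pmf p \<subseteq> insert None (Some ` V)"
    "\<And>i. i \<in> V \<Longrightarrow> pmf p (Some i) = lam i * h * exp (- \<Lambda> * h)"
    "\<And>k x. x \<in> insert None (Some ` V) \<Longrightarrow> prob {\<omega> \<in> space M. arrival k \<omega> = x} = pmf p x"
proof -
  let ?O = "insert None (Some ` V)"
  define w where "w x = (if x \<in> ?O then prob {\<omega> \<in> space M. arrival 0 \<omega> = x} else 0)" for x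
  have total: "(\<Sum>x\<in>?O. prob {\<omega> \<in> space M. arrival k \<omega> = x}) = 1" for k
  proof -
    have "(\<Sum>x\<in>?O. prob {\<omega> \<in> space M. arrival k \<omega> = x}) = prob (\<Union>x\<in>?O. {\<omega> \<in> space M. arrival k \<omega> = x})"
      using finite_V by (intro finite_measure_finite_Union [symmetric]) (auto simp: disjoint_family_on_def)
    also have "(\<Union>x\<in>?O. {\<omega> \<in> space M. arrival k \<omega> = x}) = space M"
      using sole_in[OF finite_V] by (auto simp: arrival_def)
    finally show ?thesis by (simp add: prob_space)
  qed
  have "(\<integral>\<^sup>+x. ennreal (w x) \<partial>count_space UNIV) = (\<Sum>x\<in>?O. ennreal (w x))"
    using finite_V by (intro nn_integral_count_space') (auto simp: w_def)
  also have "\<dots> = ennreal (\<Sum>x\<in>?O. w x)" by (intro sum_ennreal) (simp add: w_def)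
  also have "(\<Sum>x\<in>?O. w x) = 1" using total[of 0] by (simp add: w_def)
  finally have w_total: "(\<integral>\<^sup>+x. ennreal (w x) \<partial>count_space UNIV) = 1" by simp
  define p where "p = embed_pmf w"
  have p: "pmf p x = w x" for x
    unfolding p_def using w_total by (intro pmf_embed_pmf) (auto simp: w_def)
  have pNone: "prob {\<omega> \<in> space M. arrival k \<omega> = None} = prob {\<omega> \<in> space M. arrival 0 \<omega> = None}" for k
    using total[of k] total[of 0] finite_V by (simp add: sum.reindex prob_arrival_Some)
  show ?thesis
  proof (rule that[of p])
    show "set_pmf p \<subseteq> ?O" by (auto simp: set_pmf_iff p w_def split: if_splits)
    show "prob {\<omega> \<in> space M. arrival k \<omega> = x} = pmf p x" if "x \<in> ?O" for k x
      using that pNone[of k] by (auto simp: p w_def prob_arrival_Some)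
  qed (simp add: p w_def prob_arrival_Some)
qed

text \<open>Only finitely many lists can occur. Hence any set \<open>X\<close> gives an event, and
  its probability is a finite sum over single lists, where independence applies.\<close>

lemma prob_arrivals:
  assumes p: "set_pmf p \<subseteq> insert None (Some ` V)"
    "\<And>k x. x \<in> insert None (Some ` V) \<Longrightarrow> prob {\<omega> \<in> space M. arrival k \<omega> = x} = pmf p x"
  shows "{\<omega> \<in> space M. map (\<lambda>k. arrival k \<omega>) [0..<n] \<in> X} \<in> events"
    and "prob {\<omega> \<in> space M. map (\<lambda>k. arrival k \<omega>) [0..<n] \<in> X} = measure_pmf.prob (replicate_pmf n p) X"
proof -
  let ?O = "insert None (Some ` V)"
  let ?L = "\<lambda>\<omega>. map (\<lambda>k. arrival k \<omega>) [0..<n]"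
  define T where "T = X \<inter> {xs. set xs \<subseteq> ?O \<and> length xs = n}"
  have fin: "finite T" using finite_V finite_lists_length_eq[of ?O n] by (auto simp: T_def)
  have eq: "{\<omega> \<in> space M. ?L \<omega> = xs} = {\<omega> \<in> space M. \<forall>k<n. arrival k \<omega> = xs ! k}" if "length xs = n" for xs
    using that by (auto simp: list_eq_iff_nth_eq)
  have meas: "{\<omega> \<in> space M. ?L \<omega> = xs} \<in> events" if "length xs = n" for xs
    unfolding eq[OF that] by measurable
  have prob_xs: "prob {\<omega> \<in> space M. ?L \<omega> = xs} = pmf (replicate_pmf n p) xs" if "xs \<in> T" for xs
  proof -
    from that have xs: "length xs = n" "\<And>k. k < n \<Longrightarrow> xs ! k \<in> ?O"
      by (auto simp: T_def dest: nth_mem)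
    have "prob {\<omega> \<in> space M. ?L \<omega> = xs} = (\<Prod>k<n. prob {\<omega> \<in> space M. arrival k \<omega> = xs ! k})"
    proof (cases "n = 0")
      case False
      from indep_varsD_finite[OF indep_vars_arrival, of n "\<lambda>k. {xs ! k}"] False
      have "prob (\<Inter>k<n. arrival k -` {xs ! k} \<inter> space M) = (\<Prod>k<n. prob (arrival k -` {xs ! k} \<inter> space M))"
        by auto
      moreover have "(\<Inter>k<n. arrival k -` {xs ! k} \<inter> space M) = {\<omega> \<in> space M. ?L \<omega> = xs}"
        unfolding eq[OF xs(1)] using False by auto
      moreover have "arrival k -` {xs ! k} \<inter> space M = {\<omega> \<in> space M. arrival k \<omega> = xs ! k}" for k
        by auto
      ultimately show ?thesis by simp
    qed (use xs in \<open>simp add: prob_space\<close>)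
    also have "\<dots> = (\<Prod>k<n. pmf p (xs ! k))"
      using xs(2) p(2) by (intro prod.cong) auto
    also have "\<dots> = (\<Prod>x\<leftarrow>xs. pmf p x)"
      using xs(1) by (simp add: prod.list_conv_set_nth atLeast0LessThan)
    finally show ?thesis using pmf_replicate_pmf[of xs p] xs(1) by simp
  qed
  have "arrival k \<omega> \<in> ?O" for k \<omega>
    unfolding arrival_def by (rule sole_in[OF finite_V])
  then have L_in: "?L \<omega> \<in> {xs. set xs \<subseteq> ?O \<and> length xs = n}" for \<omega>
    by (simp only: mem_Collect_eq set_map length_map length_upt image_subset_iff) simp
  have un: "{\<omega> \<in> space M. ?L \<omega> \<in> X} = (\<Union>xs\<in>T. {\<omega> \<in> space M. ?L \<omega> = xs})"
  proof (intro equalityI subsetI)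
    fix \<omega> assume "\<omega> \<in> {\<omega> \<in> space M. ?L \<omega> \<in> X}"
    with L_in[of \<omega>] show "\<omega> \<in> (\<Union>xs\<in>T. {\<omega> \<in> space M. ?L \<omega> = xs})"
      unfolding T_def by blast
  qed (auto simp: T_def)
  show "{\<omega> \<in> space M. ?L \<omega> \<in> X} \<in> events"
    unfolding un using fin meas by (intro sets.finite_UN) (auto simp: T_def)
  have "prob {\<omega> \<in> space M. ?L \<omega> \<in> X} = (\<Sum>xs\<in>T. prob {\<omega> \<in> space M. ?L \<omega> = xs})"
    unfolding un using fin meas
    by (intro finite_measure_finite_Union) (auto simp: T_def disjoint_family_on_def)
  also have "\<dots> = (\<Sum>xs\<in>T. pmf (replicate_pmf n p) xs)" by (simp add: prob_xs)
  also have "\<dots> = measure_pmf.prob (replicate_pmf n p) T" using fin by (simp add: measure_measure_pmf_finite)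
  also have "\<dots> = measure_pmf.prob (replicate_pmf n p) X"
  proof -
    have "T \<inter> set_pmf (replicate_pmf n p) = X \<inter> set_pmf (replicate_pmf n p)"
      using p(1) by (auto simp: T_def set_replicate_pmf lists_eq_set)
    then show ?thesis by (metis measure_Int_set_pmf)
  qed
  finally show "prob {\<omega> \<in> space M. ?L \<omega> \<in> X} = measure_pmf.prob (replicate_pmf n p) X" .
qed

end

subsection \<open>Drift and positive recurrence\<close>

text \<open>A match only lowers queue lengths. An item is queued only if all neighbouring queues are
  empty, and there are no loops because edges have two elements.\<close>

lemma arrive_queue_states:
  assumes "simple_graph V E" "priority_policy V E Phi" "i \<in> V" "z \<in> queue_states V E"
  shows "arrive Phi i z \<in> queue_states V E"
proof (cases "find (\<lambda>j. z j > 0) (Phi i)")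
  case None
  then have idle: "z j = 0" if "{i, j} \<in> E" for j
    using that assms(2,3) by (auto simp: find_None_iff priority_policy_def nbrs_def)
  have "{i} \<notin> E" using assms(1) by (auto simp: simple_graph_def)
  with idle assms(3,4) None show ?thesis
    by (auto simp: arrive_def queue_states_def insert_commute)
next
  case (Some j)
  then have le: "arrive Phi i z k \<le> z k" for k by (simp add: arrive_def)
  show ?thesis unfolding queue_states_def
  proof (intro CollectI conjI allI impI)
    fix k assume "k \<notin> V"
    then show "arrive Phi i z k = 0" using assms(4) le[of k] by (auto simp: queue_states_def)
  next
    fix k l assume "{k, l} \<in> E"
    then have "z k = 0 \<or> z l = 0" using assms(4) by (auto simp: queue_states_def)
    then show "arrive Phi i z k = 0 \<or> arrive Phi i z l = 0" using le[of k] le[of l] by auto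
  qed
qed

text \<open>With \<open>g\<close> the drift at \<open>z\<close> and \<open>L\<close> the total
  intensity, the bound on the stopped walk becomes \<open>g / L \<le> C * L / \<delta>\<close> as
  the horizon grows, for every positive \<open>\<delta>\<close>. A large \<open>\<delta>\<close>
  contradicts this.\<close>

theorem drift_not_positive_recurrent:
  fixes f :: "('v \<Rightarrow> nat) \<Rightarrow> real"
  assumes mq: "matching_queue M V E lam Phi N Q"
    and bounded: "\<And>i s. i \<in> V \<Longrightarrow> s \<in> queue_states V E \<Longrightarrow> \<bar>f (arrive Phi i s) - f s\<bar> \<le> C"
    and drift: "\<And>s. s \<in> queue_states V E \<Longrightarrow> 0 \<le> (\<Sum>i\<in>V. lam i * (f (arrive Phi i s) - f s))"
    and z: "z \<in> queue_states V E" "0 < (\<Sum>i\<in>V. lam i * (f (arrive Phi i z) - f z))"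
  shows "\<not> positive_recurrent M (queue_states V E) Q"
proof
  assume "positive_recurrent M (queue_states V E) Q"
  define \<tau> where "\<tau> \<omega> = return_time z (\<lambda>t. Q z t \<omega>)" for \<omega>
  have \<tau>_finite: "(\<integral>\<^sup>+ \<omega>. \<tau> \<omega> \<partial>M) < \<infinity>"
    using \<open>positive_recurrent _ _ _\<close> z(1) by (simp add: positive_recurrent_def \<tau>_def)
  interpret prob_space M using mq by (simp add: matching_queue_def)
  define L where "L = (\<Sum>i\<in>V. lam i)"
  define g where "g = (\<Sum>i\<in>V. lam i * (f (arrive Phi i z) - f z))"
  have V: "finite V" "V \<noteq> {}" using mq z(2) by (auto simp: matching_queue_def simple_graph_def)
  have C: "0 \<le> C"
    using V(2) bounded[OF _ z(1)] by (meson abs_ge_zero ex_in_conv order.trans)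
  txt \<open>
    Slots of length \<open>T\<^sup>-\<^sup>3\<close> up to time \<open>T = Suc n\<close>: a slot with two arrivals then occurs with
    probability \<open>O(T\<^sup>-\<^sup>2)\<close>, which is negligible even after multiplication by \<open>T\<close>.
  \<close>

  define h :: "nat \<Rightarrow> real" where "h n = 1 / real (Suc n) ^ 3" for n
  define K :: "nat \<Rightarrow> nat" where "K n = Suc n ^ 4" for n
  have h_pos: "0 < h n" for n by (simp add: h_def)
  have real_K: "real (K n) = real (Suc n) ^ 4" for n by (simp only: K_def of_nat_power)
  have hK: "h n * K n = real (Suc n)" for n
    by (simp add: h_def real_K power4_eq_xxxx power3_eq_cube divide_simps del: of_nat_Suc)
  have arrivals: "poisson_arrivals M V lam N (h n)" for n
    using mq V h_pos by unfold_locales (auto simp: matching_queue_def)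
  have L: "0 < L" unfolding L_def using arrivals[of 0] by (rule poisson_arrivals.\<Lambda>_pos)

  \<comment> \<open>On \<open>A n\<close> the stopped grid walk is away from \<open>z\<close> at the
    horizon; on \<open>G n\<close> no slot is crowded, so the grid walk follows the queue.\<close>
  define A where "A n = {\<omega> \<in> space M. stopped_run (arrive Phi) z False z
      (map (\<lambda>k. poisson_arrivals.arrival V N (h n) k \<omega>) [0..<K n]) \<noteq> z}" for n
  define G where "G n = {\<omega> \<in> space M. \<forall>k<K n. (\<Sum>i\<in>V. poisson_arrivals.incr N (h n) i k \<omega>) \<le> 1}" for n

  have main: "A n \<in> events \<and> (\<forall>\<delta>>0. g / L * (1 - exp (- L * exp (- L)) ^ Suc n)
      \<le> C * (L / \<delta> + (L + \<delta>) * (Suc n * prob (A n))))" for n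
  proof -
    interpret poisson_arrivals M V lam N "h n" by (rule arrivals)
    obtain p where p: "set_pmf p \<subseteq> insert None (Some ` V)"
      "\<And>i. i \<in> V \<Longrightarrow> pmf p (Some i) = lam i * h n * exp (- \<Lambda> * h n)"
      "\<And>k x. x \<in> insert None (Some ` V) \<Longrightarrow> prob {\<omega> \<in> space M. arrival k \<omega> = x} = pmf p x"
    proof (rule arrival_pmf_exists)
      fix p
      assume "set_pmf p \<subseteq> insert None (Some ` V)"
        "\<And>i. i \<in> V \<Longrightarrow> pmf p (Some i) = lam i * h n * exp (- \<Lambda> * h n)"
        "\<And>k x. x \<in> insert None (Some ` V) \<Longrightarrow> prob {\<omega> \<in> space M. arrival k \<omega> = x} = pmf p x"
      then show thesis using that[of p] by simp
    qed
    \<comment> \<open>The factor by which the step probabilities differ from the intensities, the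
      same for all classes.\<close>
    define \<kappa> where "\<kappa> = h n * exp (- L * h n)"
    have \<kappa>: "0 < \<kappa>" using h_pos by (simp add: \<kappa>_def)
    have p\<kappa>: "pmf p (Some i) = \<kappa> * lam i" if "i \<in> V" for i
      using p(2)[OF that] by (simp add: \<kappa>_def L_def)
    have sum_p: "(\<Sum>i\<in>V. pmf p (Some i) * x i) = \<kappa> * (\<Sum>i\<in>V. lam i * x i)" for x
      by (simp add: p\<kappa> sum_distrib_left mult.assoc)
    interpret W: random_steps V p "arrive Phi" "queue_states V E" f C
    proof
      show "arrive Phi i s \<in> queue_states V E" if "i \<in> V" "s \<in> queue_states V E" for i s
        using that mq by (auto simp: matching_queue_def intro: arrive_queue_states)
      show "0 \<le> (\<Sum>i\<in>V. pmf p (Some i) * (f (arrive Phi i s) - f s))" if "s \<in> queue_states V E" for s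
        unfolding sum_p using \<kappa> drift[OF that] by (intro mult_nonneg_nonneg) auto
    qed (use V p(1) C bounded in auto)
    have \<theta>: "W.\<theta> = \<kappa> * L" using sum_p[of "\<lambda>_. 1"] by (simp add: L_def)
    have prob_A: "prob (A n) = measure_pmf.prob (replicate_pmf (K n) p)
        {xs. stopped_run (arrive Phi) z False z xs \<noteq> z}"
      and A_event: "A n \<in> events"
      using prob_arrivals[OF p(1,3), of "K n" "{xs. stopped_run (arrive Phi) z False z xs \<noteq> z}"]
      by (simp_all add: A_def)
    have K\<theta>: "K n * W.\<theta> = L * Suc n * exp (- L * h n)"
    proof -
      have "K n * W.\<theta> = L * (h n * K n) * exp (- L * h n)" by (simp add: \<theta> \<kappa>_def)
      then show ?thesis by (simp only: hK)
    qed
    have h_le: "h n \<le> 1" by (simp add: h_def)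
    \<comment> \<open>As \<open>h n \<le> 1\<close>, the mean number of steps is at least
      \<open>L * Suc n * exp (- L)\<close>, which bounds the probability of no step uniformly in the
      mesh.\<close>
    have q: "(1 - W.\<theta>) ^ K n \<le> exp (- L * exp (- L)) ^ Suc n"
    proof -
      have "(1 - W.\<theta>) ^ K n \<le> exp (- W.\<theta>) ^ K n"
        using exp_ge_add_one_self[of "- W.\<theta>"] W.\<theta>_bounds by (intro power_mono) auto
      also have "\<dots> = exp (- (K n * W.\<theta>))" by (simp flip: exp_of_nat_mult)
      also have "\<dots> \<le> exp (- (L * Suc n * exp (- L)))"
        unfolding K\<theta> using L h_le by (simp add: mult_left_mono)
      also have "\<dots> = exp (- L * exp (- L)) ^ Suc n"
        unfolding exp_of_nat_mult [symmetric] by (simp add: algebra_simps)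
      finally show ?thesis .
    qed
    have "g / L * (1 - exp (- L * exp (- L)) ^ Suc n)
      \<le> C * (L / \<delta> + (L + \<delta>) * (Suc n * prob (A n)))" if \<delta>: "0 < \<delta>" for \<delta>
    proof -
      have K\<theta>_le: "K n * W.\<theta> \<le> L * Suc n"
        unfolding K\<theta> using L h_pos by (intro mult_left_le) auto
      have "g / L * (1 - exp (- L * exp (- L)) ^ Suc n) \<le> g / L * (1 - (1 - W.\<theta>) ^ K n)"
        using q z(2) L by (intro mult_left_mono) (auto simp: g_def)
      also have "1 - (1 - W.\<theta>) ^ K n = W.\<theta> * (\<Sum>j<K n. (1 - W.\<theta>) ^ j)"
        by (simp add: one_diff_power_eq)
      also have "g / L * (W.\<theta> * (\<Sum>j<K n. (1 - W.\<theta>) ^ j)) = \<kappa> * g * (\<Sum>j<K n. (1 - W.\<theta>) ^ j)"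
        using L by (simp add: \<theta>)
      also have "\<kappa> * g = (\<Sum>i\<in>V. pmf p (Some i) * (f (arrive Phi i z) - f z))"
        by (simp only: sum_p g_def)
      \<comment> \<open>The free constant of the bound is taken as \<open>\<delta> * Suc n\<close>,
        so that the variance term stays at \<open>L / \<delta>\<close> as the horizon grows.\<close>
      also have "\<dots> * (\<Sum>j<K n. (1 - W.\<theta>) ^ j) \<le> C * (K n * W.\<theta> / (\<delta> * Suc n) +
          (K n * W.\<theta> + \<delta> * Suc n) * prob (A n))"
        unfolding prob_A using z(1) \<delta> by (intro W.stopped_run_bound) auto
      also have "\<dots> \<le> C * (L * Suc n / (\<delta> * Suc n) + (L * Suc n + \<delta> * Suc n) * prob (A n))"
        using K\<theta>_le \<delta> C
        by (intro mult_left_mono add_mono divide_right_mono mult_right_mono) auto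
      also have "\<dots> = C * (L / \<delta> + (L + \<delta>) * (Suc n * prob (A n)))"
        by (simp add: algebra_simps del: of_nat_Suc)
      finally show ?thesis .
    qed
    with A_event show ?thesis by blast
  qed

  have G_event: "G n \<in> events" and prob_not_G: "prob (space M - G n) \<le> L\<^sup>2 / real (Suc n) ^ 2" for n
  proof -
    interpret poisson_arrivals M V lam N "h n" by (rule arrivals)
    have [measurable]: "(\<lambda>\<omega>. \<Sum>i\<in>V. incr i k \<omega>) \<in> measurable M (count_space UNIV)" for k
      by measurable
    show "G n \<in> events" unfolding G_def by measurable
    have "space M - G n = {\<omega> \<in> space M. \<not> (\<forall>k<K n. (\<Sum>i\<in>V. incr i k \<omega>) \<le> 1)}"
      by (auto simp: G_def)
    then have "prob (space M - G n) \<le> K n * (L * h n)\<^sup>2"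
      using prob_some_crowded[of "K n"] by (simp add: L_def)
    also have "\<dots> = L\<^sup>2 / real (Suc n) ^ 2"
      by (simp add: real_K h_def power_divide power_mult_distrib divide_simps del: of_nat_Suc
          flip: power_mult power_add)
    finally show "prob (space M - G n) \<le> L\<^sup>2 / real (Suc n) ^ 2" .
  qed

  have "AE \<omega> in M. \<forall>i\<in>V. mono_on {0..} (\<lambda>t. N i t \<omega>) \<and> (\<forall>t\<ge>0. continuous (at_right t) (\<lambda>u. N i u \<omega>))"
    using mq V(1) by (auto simp: AE_ball_countable countable_finite matching_queue_def poisson_process_def elim: AE_mp)
  moreover have "AE \<omega> in M. queue_path V Phi (\<lambda>i t. N i t \<omega>) z (\<lambda>t. Q z t \<omega>)"
    using mq z(1) by (simp add: matching_queue_def)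
  ultimately have \<tau>_ge: "AE \<omega> in M. \<forall>n. \<omega> \<in> A n \<inter> G n \<longrightarrow> ennreal (Suc n) \<le> \<tau> \<omega>"
  proof eventually_elim
    case (elim \<omega>)
    show ?case
    proof (intro allI impI)
      fix n assume \<omega>: "\<omega> \<in> A n \<inter> G n"
      interpret poisson_arrivals M V lam N "h n" by (rule arrivals)
      have "ennreal (h n * K n) \<le> return_time z (\<lambda>t. Q z t \<omega>)"
        using \<omega> elim V(1) h_pos
        by (intro return_time_ge[where a="\<lambda>i t. N i t \<omega>" and V=V and Phi=Phi])
          (auto simp: A_def G_def arrival_def incr_def)
      then show "ennreal (Suc n) \<le> \<tau> \<omega>" by (simp only: hK \<tau>_def)
    qed
  qed

  txt \<open>
    The return time need not be measurable, so the dominating function is the supremum of its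
    measurable lower bounds.
  \<close>

  define u where "u n \<omega> = ennreal (Suc n) * indicator (A n \<inter> G n) \<omega>" for n \<omega>
  define U where "U \<omega> = (SUP n. u n \<omega>)" for \<omega>
  have u_meas [measurable]: "u n \<in> borel_measurable M" for n
    unfolding u_def using main G_event by (intro borel_measurable_times_ennreal borel_measurable_indicator) auto
  have [measurable]: "U \<in> borel_measurable M" unfolding U_def by measurable
  have "(\<integral>\<^sup>+ \<omega>. U \<omega> \<partial>M) \<le> (\<integral>\<^sup>+ \<omega>. \<tau> \<omega> \<partial>M)"
    using \<tau>_ge by (intro nn_integral_mono_AE, eventually_elim)
      (auto simp: U_def u_def intro!: SUP_least split: split_indicator)
  with \<tau>_finite have U_finite: "(\<integral>\<^sup>+ \<omega>. U \<omega> \<partial>M) < \<infinity>" by (rule order_le_less_trans[rotated])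
  have "AE \<omega> in M. U \<omega> \<noteq> \<infinity>" using U_finite by (intro nn_integral_PInf_AE) auto
  \<comment> \<open>The value of \<open>u n\<close> is either \<open>0\<close> or
    \<open>Suc n\<close>, so a finite supremum forces it to vanish for large
    \<open>n\<close>.\<close>
  then have u_lim: "AE \<omega> in M. (\<lambda>n. u n \<omega>) \<longlonglongrightarrow> 0"
  proof eventually_elim
    case (elim \<omega>)
    then obtain r where r: "0 \<le> r" "U \<omega> = ennreal r" by (cases "U \<omega>") auto
    obtain m :: nat where m: "r < m" using reals_Archimedean2 by blast
    have "u n \<omega> = 0" if "m \<le> n" for n
    proof (rule ccontr)
      assume "u n \<omega> \<noteq> 0"
      then have "u n \<omega> = ennreal (Suc n)" by (auto simp: u_def split: split_indicator_asm)
      then have "ennreal (Suc n) \<le> ennreal r" unfolding r(2)[symmetric] U_def by (metis SUP_upper UNIV_I)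
      then have "real (Suc n) \<le> r" using r(1) by (simp only: ennreal_le_iff)
      with m that show False by simp
    qed
    then show ?case by (intro tendsto_eventually eventually_sequentiallyI[of m])
  qed
  \<comment> \<open>Dominated convergence shows that \<open>prob (A n \<inter> G n)\<close> is
    o(1/T).\<close>
  have "(\<lambda>n. \<integral>\<^sup>+ \<omega>. u n \<omega> \<partial>M) \<longlonglongrightarrow> (\<integral>\<^sup>+ \<omega>. 0 \<partial>M)"
    using U_finite u_lim
    by (intro nn_integral_dominated_convergence[where w=U]) (auto simp: U_def intro!: SUP_upper)
  moreover have "(\<integral>\<^sup>+ \<omega>. u n \<omega> \<partial>M) = ennreal (Suc n * prob (A n \<inter> G n))" for n
  proof -
    have AG: "A n \<inter> G n \<in> events" using main G_event by auto
    show ?thesis unfolding u_def nn_integral_cmult_indicator[OF AG] emeasure_eq_measure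
      by (simp add: ennreal_mult del: of_nat_Suc)
  qed
  ultimately have "(\<lambda>n. ennreal (Suc n * prob (A n \<inter> G n))) \<longlonglongrightarrow> ennreal 0"
    by simp
  then have lim_AG: "(\<lambda>n. Suc n * prob (A n \<inter> G n)) \<longlonglongrightarrow> 0"
    by (subst (asm) tendsto_ennreal_iff) (auto simp del: of_nat_Suc)
  \<comment> \<open>Dropping \<open>G n\<close> costs at most T times the crowding probability,
    which is O(1/T).\<close>
  have lim_A: "(\<lambda>n. Suc n * prob (A n)) \<longlonglongrightarrow> 0"
  proof (rule tendsto_sandwich[where f="\<lambda>_. 0" and
        h="\<lambda>n. Suc n * prob (A n \<inter> G n) + L\<^sup>2 / Suc n"])
    have "Suc n * prob (A n) \<le> Suc n * prob (A n \<inter> G n) + L\<^sup>2 / Suc n" for n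
    proof -
      have "prob (A n) \<le> prob ((A n \<inter> G n) \<union> (space M - G n))"
        using main G_event sets.sets_into_space[of "A n" M]
        by (intro finite_measure_mono sets.Un sets.Int sets.Diff) auto
      also have "\<dots> \<le> prob (A n \<inter> G n) + prob (space M - G n)"
        using main G_event by (intro measure_Un_le) auto
      finally have "prob (A n) \<le> prob (A n \<inter> G n) + L\<^sup>2 / real (Suc n) ^ 2"
        using prob_not_G[of n] by simp
      then have "Suc n * prob (A n) \<le> Suc n * (prob (A n \<inter> G n) + L\<^sup>2 / real (Suc n) ^ 2)"
        by (intro mult_left_mono) auto
      also have "\<dots> = Suc n * prob (A n \<inter> G n) + L\<^sup>2 / Suc n"
        by (simp add: distrib_left power2_eq_square del: of_nat_Suc)
      finally show ?thesis .
    qed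
    then show "\<forall>\<^sub>F n in sequentially. Suc n * prob (A n) \<le> Suc n * prob (A n \<inter> G n) + L\<^sup>2 / Suc n"
      by simp
    have "(\<lambda>n. L\<^sup>2 / Suc n) \<longlonglongrightarrow> 0"
      by (rule LIMSEQ_Suc[OF lim_const_over_n])
    from tendsto_add[OF lim_AG this]
    show "(\<lambda>n. Suc n * prob (A n \<inter> G n) + L\<^sup>2 / Suc n) \<longlonglongrightarrow> 0" by simp
  qed auto

  \<comment> \<open>The limiting inequality amounts to
    \<open>g * \<delta> \<le> C * L\<^sup>2\<close>, which this choice violates by one.\<close>
  define \<delta> where "\<delta> = (C * L\<^sup>2 + 1) / g"
  have g: "0 < g" using z(2) by (simp add: g_def)
  have \<delta>: "0 < \<delta>" using g C by (simp add: \<delta>_def add_nonneg_pos)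
  have lim_q: "(\<lambda>n. exp (- L * exp (- L)) ^ Suc n) \<longlonglongrightarrow> 0"
    using L by (intro LIMSEQ_Suc[OF LIMSEQ_power_zero]) auto
  have "g / L * (1 - 0) \<le> C * (L / \<delta> + (L + \<delta>) * 0)"
  proof (rule LIMSEQ_le)
    show "(\<lambda>n. g / L * (1 - exp (- L * exp (- L)) ^ Suc n)) \<longlonglongrightarrow> g / L * (1 - 0)"
      by (intro tendsto_intros lim_q)
    show "(\<lambda>n. C * (L / \<delta> + (L + \<delta>) * (Suc n * prob (A n)))) \<longlonglongrightarrow> C * (L / \<delta> + (L + \<delta>) * 0)"
      by (intro tendsto_intros lim_A)
  qed (use main \<delta> in blast)
  then have "g * \<delta> \<le> C * L\<^sup>2"
    using L \<delta> by (simp add: field_simps power2_eq_square)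
  then show False using g by (simp add: \<delta>_def)
qed

subsection \<open>The 5-cycle\<close>

lemma nbrs_cycle5:
  "nbrs cycle5_edges 1 = {2, 3}" "nbrs cycle5_edges 2 = {1, 4}" "nbrs cycle5_edges 3 = {1, 5}"
  "nbrs cycle5_edges 4 = {2, 5}" "nbrs cycle5_edges 5 = {3, 4}"
  by (auto simp: nbrs_def cycle5_edges_def doubleton_eq_iff)

text \<open>The independent sets \<open>{1}\<close> and \<open>{2}\<close> make the denominators
  positive; \<open>{1, 5}\<close> and \<open>{2, 5}\<close> will give \<open>A < 1\<close> and
  \<open>B < 1\<close>.\<close>

lemma Ncond_cycle5:
  assumes "lam \<in> Ncond cycle5_nodes cycle5_edges"
  shows "\<And>i. i \<in> {1, 2, 3, 4, 5} \<Longrightarrow> 0 < lam i" "lam 1 < lam 2 + lam 3" "lam 2 < lam 1 + lam 4"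
    "lam 1 + lam 5 < lam 2 + lam 3 + lam 4" "lam 2 + lam 5 < lam 1 + lam 3 + lam 4"
proof -
  show "\<And>i. i \<in> {1, 2, 3, 4, 5} \<Longrightarrow> 0 < lam i"
    using assms by (auto simp: Ncond_def cycle5_nodes_def)
  have ineq: "(\<Sum>i\<in>I. lam i) < (\<Sum>j\<in>(\<Union>i\<in>I. nbrs cycle5_edges i). lam j)"
    if "independent_set cycle5_nodes cycle5_edges I" "I \<noteq> {}" for I
    using assms that by (simp add: Ncond_def)
  have indep: "independent_set cycle5_nodes cycle5_edges I" if "I \<in> {{1}, {2}, {1, 5}, {2, 5}}" for I
    using that by (auto simp: independent_set_def cycle5_nodes_def cycle5_edges_def doubleton_eq_iff)
  show "lam 1 < lam 2 + lam 3" "lam 2 < lam 1 + lam 4"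
    using ineq[OF indep, of "{1}"] ineq[OF indep, of "{2}"] by (simp_all add: nbrs_cycle5 del: One_nat_def)
  have "{2, 3} \<union> {3, 4} = {2, 3, 4 :: nat}" "{1, 4} \<union> {3, 4} = {1, 3, 4 :: nat}" by auto
  then show "lam 1 + lam 5 < lam 2 + lam 3 + lam 4" "lam 2 + lam 5 < lam 1 + lam 3 + lam 4"
    using ineq[OF indep, of "{1, 5}"] ineq[OF indep, of "{2, 5}"]
    by (simp_all add: nbrs_cycle5 del: One_nat_def)
qed

theorem corollary3:
  fixes M :: "'w measure"
    and lam :: "nat \<Rightarrow> real"
    and N :: "nat \<Rightarrow> real \<Rightarrow> 'w \<Rightarrow> nat"
    and Q :: "(nat \<Rightarrow> nat) \<Rightarrow> real \<Rightarrow> 'w \<Rightarrow> nat \<Rightarrow> nat"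
    and a \<alpha> :: real
  assumes "lam \<in> Ncond cycle5_nodes cycle5_edges"
    and "stable_matching_queue M cycle5_nodes cycle5_edges lam cycle5_priority N Q"
    and "a = lam 3 * (lam 1 + lam 4) / (lam 1 + lam 4 - lam 2)
           + lam 4 * (lam 2 + lam 3) / (lam 2 + lam 3 - lam 1)"
    and "\<alpha> = inverse (1 + lam 1 / (lam 2 + lam 3 - lam 1) + lam 2 / (lam 1 + lam 4 - lam 2))"
  shows "lam 5 < a * \<alpha>"
proof (rule ccontr)
  assume "\<not> lam 5 < a * \<alpha>"
  then have ge: "a * \<alpha> \<le> lam 5" by simp
  note ncond = Ncond_cycle5[OF assms(1)]
  have pos: "0 < lam 1" "0 < lam 2" "0 < lam 3" "0 < lam 4" "0 < lam 5"
    using ncond(1) by auto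
  define \<mu>1 \<mu>2 where "\<mu>1 = lam 2 + lam 3 - lam 1" and "\<mu>2 = lam 1 + lam 4 - lam 2"
  have \<mu>: "0 < \<mu>1" "0 < \<mu>2" using ncond(2,3) by (simp_all add: \<mu>1_def \<mu>2_def)
  txt \<open>
    While \<open>Q\<^sub>5 > 0\<close>, the pair \<open>(Q\<^sub>1, Q\<^sub>2)\<close> is a birth-death chain; \<open>A Q\<^sub>1 + B Q\<^sub>2\<close> solves the
    Poisson equation that averages the drift of \<open>Q\<^sub>5\<close> to \<open>lam 5 - a * \<alpha>\<close>.
  \<close>
  define A B where "A = (a * \<alpha> - lam 4) / \<mu>1" and "B = (a * \<alpha> - lam 3) / \<mu>2"
  \<comment> \<open>These say that the drift is exactly \<open>lam 5 - a * \<alpha>\<close> when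
    class 1, respectively class 2, is queued.\<close>
  have A\<mu>: "A * (lam 2 + lam 3 - lam 1) = a * \<alpha> - lam 4" and B\<mu>: "B * (lam 1 + lam 4 - lam 2) = a * \<alpha> - lam 3"
    using \<mu> by (simp_all add: A_def B_def \<mu>1_def \<mu>2_def)
  have A1: "A < 1" and B1: "B < 1"
    using ge ncond(4,5) \<mu> by (simp_all add: A_def B_def \<mu>1_def \<mu>2_def)
  \<comment> \<open>The same drift value for states with the queues 1 to 4 empty. This is the
    equation that fixes the value of \<open>a * \<alpha>\<close>.\<close>
  have balance: "lam 1 * A + lam 2 * B = lam 3 + lam 4 - a * \<alpha>"
  proof -
    have "0 < 1 + lam 1 / \<mu>1 + lam 2 / \<mu>2" using pos \<mu> by (intro add_pos_pos) auto
    then have "a * \<alpha> * (1 + lam 1 / \<mu>1 + lam 2 / \<mu>2) = a"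
      using assms(4) by (simp add: \<mu>1_def \<mu>2_def)
    also have "a = lam 3 * (\<mu>2 + lam 2) / \<mu>2 + lam 4 * (\<mu>1 + lam 1) / \<mu>1"
      unfolding assms(3) by (simp add: \<mu>1_def \<mu>2_def)
    also have "\<dots> = lam 3 + lam 4 + lam 3 * lam 2 / \<mu>2 + lam 4 * lam 1 / \<mu>1"
      using \<mu> by (simp add: field_simps)
    finally show ?thesis by (simp add: A_def B_def diff_divide_distrib algebra_simps)
  qed
  define f :: "(nat \<Rightarrow> nat) \<Rightarrow> real" where
    "f s = real (s 5) - real (s 3) - real (s 4) + A * real (s 1) + B * real (s 2)" for s
  let ?S = "queue_states cycle5_nodes cycle5_edges"
  let ?arrive = "arrive cycle5_priority"
  have S: "s 1 = 0 \<or> s 2 = 0" "s 1 = 0 \<or> s 3 = 0" "s 2 = 0 \<or> s 4 = 0" "s 3 = 0 \<or> s 5 = 0"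
    "s 4 = 0 \<or> s 5 = 0" if "s \<in> ?S" for s
    using that by (auto simp: queue_states_def cycle5_edges_def)
  \<comment> \<open>Being queued and being matched with 3 or 4 both raise \<open>f\<close> by one
    for class 5; likewise, for classes 3 and 4, being queued and being matched with 5 both lower it
    by one. Hence no case depends on \<open>s 5\<close>.\<close>
  have step: "f (?arrive 1 s) - f s = (if 0 < s 2 then - B else if 0 < s 3 then 1 else A)"
    "f (?arrive 2 s) - f s = (if 0 < s 1 then - A else if 0 < s 4 then 1 else B)"
    "f (?arrive 3 s) - f s = (if 0 < s 1 then - A else - 1)"
    "f (?arrive 4 s) - f s = (if 0 < s 2 then - B else - 1)"
    "f (?arrive 5 s) - f s = 1" for s
    by (auto simp: arrive_def cycle5_priority_def f_def of_nat_diff algebra_simps)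
  have drift_eq: "(\<Sum>i\<in>cycle5_nodes. lam i * (f (?arrive i s) - f s)) =
      lam 1 * (if 0 < s 2 then - B else if 0 < s 3 then 1 else A) +
      lam 2 * (if 0 < s 1 then - A else if 0 < s 4 then 1 else B) +
      lam 3 * (if 0 < s 1 then - A else - 1) + lam 4 * (if 0 < s 2 then - B else - 1) + lam 5" for s
    unfolding step[symmetric] by (simp add: cycle5_nodes_def step(5))
  have "\<not> positive_recurrent M ?S Q"
  proof (rule drift_not_positive_recurrent[where f=f and C="1 + \<bar>A\<bar> + \<bar>B\<bar>" and z="(\<lambda>_. 0)(3 := 1)"])
    show "matching_queue M cycle5_nodes cycle5_edges lam cycle5_priority N Q"
      using assms(2) by (simp add: stable_matching_queue_def)
    show "\<bar>f (?arrive i s) - f s\<bar> \<le> 1 + \<bar>A\<bar> + \<bar>B\<bar>" if "i \<in> cycle5_nodes" for i s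
    proof -
      from that consider "i = 1" | "i = 2" | "i = 3" | "i = 4" | "i = 5"
        by (auto simp: cycle5_nodes_def)
      then show ?thesis by cases (simp_all only: step split: if_split, simp_all)
    qed
    show "0 \<le> (\<Sum>i\<in>cycle5_nodes. lam i * (f (?arrive i s) - f s))" if s: "s \<in> ?S" for s
    proof -
      \<comment> \<open>Adjacent classes are never queued together.\<close>
      consider "0 < s 1" "s 2 = 0" "s 3 = 0" | "0 < s 2" "s 1 = 0" "s 4 = 0" | "s 1 = 0" "s 2 = 0"
        using S[OF s] by auto
      then show ?thesis
      proof cases
        case 1
        then show ?thesis unfolding drift_eq using A\<mu> ge by (simp add: algebra_simps)
      next
        case 2
        then show ?thesis unfolding drift_eq using B\<mu> ge by (simp add: algebra_simps)
      next
        case 3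
        \<comment> \<open>A queued item of class 3 or 4 replaces \<open>A\<close> or
          \<open>B\<close> by 1, which can only raise the drift.\<close>
        have "lam 1 * A \<le> lam 1 * (if 0 < s 3 then 1 else A)"
          "lam 2 * B \<le> lam 2 * (if 0 < s 4 then 1 else B)"
          using A1 B1 pos by (auto intro!: mult_left_mono)
        with 3 show ?thesis unfolding drift_eq using balance ge by simp
      qed
    qed
    show "(\<lambda>_. 0)(3 := 1) \<in> ?S"
      by (auto simp: queue_states_def cycle5_nodes_def cycle5_edges_def doubleton_eq_iff)
    \<comment> \<open>In this state the drift exceeds \<open>lam 5 - a * \<alpha>\<close> by
      \<open>lam 1 * (1 - A)\<close>, so it is positive even if
      \<open>lam 5 = a * \<alpha>\<close>.\<close>
    have "lam 1 * A < lam 1" using A1 pos by simp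
    then show "0 < (\<Sum>i\<in>cycle5_nodes. lam i * (f (?arrive i ((\<lambda>_. 0)(3 := 1))) - f ((\<lambda>_. 0)(3 := 1))))"
      unfolding drift_eq using balance ge by simp
  qed
  then show False using assms(2) by (simp add: stable_matching_queue_def)
qed

end
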